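(* Let $\mathbf{s}=(s_1,\dots,s_d)$ and $\mathbf{r}=(r_1,\dots,r_d)$ be two $d$-tuples of operators such that the operator system $\mathcal{S}(\mathbf{s})$ is $N$-subhomogeneous. If the mapping $r_i\mapsto s_i$ ($i=1,\dots,d$) defines a unital $N$-positive map $\phi:\mathcal{S}(\mathbf{r})\to\mathcal{S}(\mathbf{s})$, then $\phi$ is completely positive.
   Context: A $d$-tuple of operators is a tuple of elements of a unital $C^*$-algebra (equivalently of some $B(\mathcal{H})$); the two tuples may live in different algebras. $\mathcal{S}(\mathbf{s})$ is the operator system (unital self-adjoint linear subspace) generated by $\mathbf{s}$. $\mathbb{M}_n$ denotes the complex $n\times n$ matrices and $\mathbb{M}_{m,n}$ the complex $m\times n$ matrices. A linear map is $n$-positive if its entrywise amplification to $n\times n$ matrices is positive. For an operator system $\mathcal{S}$, $\mathrm{UCP}(\mathcal{S},\mathbb{M}_n)$ is the set of unital completely positive maps $\mathcal{S}\to\mathbb{M}_n$. A point $\phi\in \mathrm{UCP}(\mathcal{S},\mathbb{M}_n)$ is matrix extreme if whenever $\phi=\sum_{i=1}^k\gamma_i^*\phi_i\gamma_i$ with $\phi_i\in \mathrm{UCP}(\mathcal{S},\mathbb{M}_{n_i})$, each $\gamma_i\in\mathbb{M}_{n_i,n}$ surjective, and $\sum_i\gamma_i^*\gamma_i=1_n$, then for all $i$, $n_i=n$ and $\phi=u_i^*\phi_iu_i$ for some unitary $u_i\in\mathbb{M}_n$. $\partial\,\mathrm{UCP}(\mathcal{S},\mathbb{M}_n)$ is the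 set of matrix extreme points at level $n$. $\mathcal{S}$ is $N$-subhomogeneous if $N$ is the smallest positive integer with $\partial\,\mathrm{UCP}(\mathcal{S},\mathbb{M}_n)=\emptyset$ for all $n>N$. *)

theory Defs
  imports
    "HOL-Analysis.Bounded_Linear_Function"
    "HOL-Library.Complex_Order"
    "Jordan_Normal_Form.Schur_Decomposition"
begin

section \<open>Complex Hilbert spaces and bounded operators\<close>

class complex_vector = real_vector +
  fixes scaleC :: "complex \<Rightarrow> 'a \<Rightarrow> 'a"  (infixr \<open>*\<^sub>C\<close> 75)
  assumes scaleC_add_right: "a *\<^sub>C (x + y) = a *\<^sub>C x + a *\<^sub>C y"
    and scaleC_add_left: "(a + b) *\<^sub>C x = a *\<^sub>C x + b *\<^sub>C x"
    and scaleC_scaleC: "a *\<^sub>C b *\<^sub>C x = (a * b) *\<^sub>C x"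
    and scaleC_of_real: "of_real t *\<^sub>C x = t *\<^sub>R x"

text \<open>
  The complex inner product is linear in its first argument (as is \<open>\<bullet>c\<close> on complex vectors).
  Its real part is the inner product of the underlying real Hilbert space, so the norm, the
  topology and completeness are those of the library.
\<close>

class complex_hilbert = complex_vector + real_inner + complete_space +
  fixes cinner :: "'a \<Rightarrow> 'a \<Rightarrow> complex"
  assumes cinner_commute: "cinner x y = cnj (cinner y x)"
    and cinner_add_left: "cinner (x + y) z = cinner x z + cinner y z"
    and cinner_scaleC_left: "cinner (c *\<^sub>C x) y = c * cinner x y"
    and Re_cinner: "Re (cinner x y) = inner x y"
begin

lemma norm_scaleC: "norm (c *\<^sub>C x) = cmod c * norm x"
proof -
  have real: "Im (cinner x x) = 0"
    using cinner_commute[of x x] by (metis cnj.simps(2) neg_equal_zero)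
  have "cinner (c *\<^sub>C x) (c *\<^sub>C x) = c * cnj (cinner (c *\<^sub>C x) x)"
    using cinner_scaleC_left[of c x "c *\<^sub>C x"] cinner_commute[of x "c *\<^sub>C x"] by simp
  also have "\<dots> = (c * cnj c) * cnj (cinner x x)"
    using cinner_scaleC_left[of c x x] by simp
  finally have "inner (c *\<^sub>C x) (c *\<^sub>C x) = (cmod c)\<^sup>2 * inner x x"
    using Re_cinner[of x x] Re_cinner[of "c *\<^sub>C x" "c *\<^sub>C x"] real
    by (simp add: complex_norm_square[symmetric])
  then show ?thesis
    by (simp add: norm_eq_sqrt_inner real_sqrt_mult)
qed

end

lemma bounded_linear_scaleC: "bounded_linear (\<lambda>x :: 'a::complex_hilbert. c *\<^sub>C x)"
proof (rule bounded_linear_intro[where K = "cmod c"])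
  fix t and x :: 'a
  show "c *\<^sub>C (t *\<^sub>R x) = t *\<^sub>R (c *\<^sub>C x)"
    by (metis scaleC_of_real scaleC_scaleC mult.commute)
qed (simp_all add: scaleC_add_right norm_scaleC)

instantiation blinfun :: (real_normed_vector, complex_hilbert) complex_vector
begin

lift_definition scaleC_blinfun :: "complex \<Rightarrow> ('a \<Rightarrow>\<^sub>L 'b) \<Rightarrow> ('a \<Rightarrow>\<^sub>L 'b)"
  is "\<lambda>c T x. c *\<^sub>C T x"
  by (rule bounded_linear_compose[OF bounded_linear_scaleC])

instance
  by standard
    (transfer, auto simp: scaleC_add_right scaleC_add_left scaleC_scaleC scaleC_of_real)+

end

text \<open>The algebra \<open>B(H)\<close>; the type \<open>'a \<Rightarrow>\<^sub>L 'a\<close> alone only provides real-linearity.\<close>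

definition bounded_operators :: "('a::complex_hilbert \<Rightarrow>\<^sub>L 'a) set" where
  "bounded_operators = {T. \<forall>c x. blinfun_apply T (c *\<^sub>C x) = c *\<^sub>C blinfun_apply T x}"

definition is_adjoint :: "('a::complex_hilbert \<Rightarrow>\<^sub>L 'a) \<Rightarrow> ('a \<Rightarrow>\<^sub>L 'a) \<Rightarrow> bool" where
  "is_adjoint T T' \<longleftrightarrow> (\<forall>x y. cinner (T x) y = cinner x (T' y))"

section \<open>Operator systems\<close>

definition operator_system :: "('a::complex_hilbert \<Rightarrow>\<^sub>L 'a) set \<Rightarrow> bool" where
  "operator_system S \<longleftrightarrow>
     S \<subseteq> bounded_operators \<and>
     id_blinfun \<in> S \<and>
     (\<forall>A\<in>S. \<forall>B\<in>S. A + B \<in> S) \<and>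
     (\<forall>c. \<forall>A\<in>S. c *\<^sub>C A \<in> S) \<and>
     (\<forall>A\<in>S. \<exists>B\<in>S. is_adjoint A B)"

text \<open>A \<open>d\<close>-tuple is given by the values of a sequence at the indices \<open>0, \<dots>, d - 1\<close>.\<close>

definition generated_system ::
  "nat \<Rightarrow> (nat \<Rightarrow> ('a::complex_hilbert \<Rightarrow>\<^sub>L 'a)) \<Rightarrow> ('a \<Rightarrow>\<^sub>L 'a) set" where
  "generated_system d s = operator_system hull (s ` {..<d})"

section \<open>Positivity of matrices and of maps\<close>

text \<open>
  An \<open>n \<times> n\<close> matrix over \<open>B(H)\<close> is a function of two indices below \<open>n\<close>. It is positive if it is
  positive as an operator on the \<open>n\<close>-fold direct sum of \<open>H\<close>. In the order on the complex numbers
  used here, \<open>0 \<le> z\<close> means that \<open>z\<close> is real and nonnegative.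
\<close>

definition positive_op_matrix :: "nat \<Rightarrow> (nat \<Rightarrow> nat \<Rightarrow> ('a::complex_hilbert \<Rightarrow>\<^sub>L 'a)) \<Rightarrow> bool" where
  "positive_op_matrix n X \<longleftrightarrow>
     (\<forall>h. 0 \<le> (\<Sum>i<n. \<Sum>j<n. cinner (X i j (h j)) (h i)))"

text \<open>The same for a \<open>k \<times> k\<close> matrix over the complex \<open>n \<times> n\<close> matrices.\<close>

definition positive_block_matrix :: "nat \<Rightarrow> nat \<Rightarrow> (nat \<Rightarrow> nat \<Rightarrow> complex mat) \<Rightarrow> bool" where
  "positive_block_matrix n k X \<longleftrightarrow>
     (\<forall>h. (\<forall>i<k. h i \<in> carrier_vec n) \<longrightarrow>
        0 \<le> (\<Sum>i<k. \<Sum>j<k. (X i j *\<^sub>v h j) \<bullet>c h i))"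

definition linear_between ::
  "('a::complex_hilbert \<Rightarrow>\<^sub>L 'a) set \<Rightarrow> ('b::complex_hilbert \<Rightarrow>\<^sub>L 'b) set
     \<Rightarrow> (('a \<Rightarrow>\<^sub>L 'a) \<Rightarrow> ('b \<Rightarrow>\<^sub>L 'b)) \<Rightarrow> bool" where
  "linear_between S T \<phi> \<longleftrightarrow>
     (\<forall>A\<in>S. \<phi> A \<in> T) \<and>
     (\<forall>A\<in>S. \<forall>B\<in>S. \<phi> (A + B) = \<phi> A + \<phi> B) \<and>
     (\<forall>c. \<forall>A\<in>S. \<phi> (c *\<^sub>C A) = c *\<^sub>C \<phi> A)"

definition n_positive ::
  "nat \<Rightarrow> ('a::complex_hilbert \<Rightarrow>\<^sub>L 'a) set
     \<Rightarrow> (('a \<Rightarrow>\<^sub>L 'a) \<Rightarrow> ('b::complex_hilbert \<Rightarrow>\<^sub>L 'b)) \<Rightarrow> bool" where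
  "n_positive n S \<phi> \<longleftrightarrow>
     (\<forall>X. (\<forall>i<n. \<forall>j<n. X i j \<in> S) \<and> positive_op_matrix n X
        \<longrightarrow> positive_op_matrix n (\<lambda>i j. \<phi> (X i j)))"

definition completely_positive ::
  "('a::complex_hilbert \<Rightarrow>\<^sub>L 'a) set \<Rightarrow> (('a \<Rightarrow>\<^sub>L 'a) \<Rightarrow> ('b::complex_hilbert \<Rightarrow>\<^sub>L 'b)) \<Rightarrow> bool" where
  "completely_positive S \<phi> \<longleftrightarrow> (\<forall>n\<ge>1. n_positive n S \<phi>)"

section \<open>Matrix states and matrix extreme points\<close>

text \<open>
  Only the values on \<open>S\<close> of a map in \<open>UCP S n\<close> are relevant; accordingly, maps are compared
  only on \<open>S\<close> below.
\<close>

definition UCP :: "('a::complex_hilbert \<Rightarrow>\<^sub>L 'a) set \<Rightarrow> nat \<Rightarrow> (('a \<Rightarrow>\<^sub>L 'a) \<Rightarrow> complex mat) set" where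
  "UCP S n = {\<phi>.
     (\<forall>A\<in>S. \<phi> A \<in> carrier_mat n n) \<and>
     (\<forall>A\<in>S. \<forall>B\<in>S. \<phi> (A + B) = \<phi> A + \<phi> B) \<and>
     (\<forall>c. \<forall>A\<in>S. \<phi> (c *\<^sub>C A) = c \<cdot>\<^sub>m \<phi> A) \<and>
     \<phi> id_blinfun = 1\<^sub>m n \<and>
     (\<forall>k\<ge>1. \<forall>X. (\<forall>i<k. \<forall>j<k. X i j \<in> S) \<and> positive_op_matrix k X
        \<longrightarrow> positive_block_matrix n k (\<lambda>i j. \<phi> (X i j)))}"

text \<open>
  The matrix type has no sum operator over index sets, as its zero depends on the dimension; a
  sum of \<open>n \<times> n\<close> matrices is formed entrywise.
\<close>

definition mat_sum :: "nat \<Rightarrow> nat \<Rightarrow> (nat \<Rightarrow> complex mat) \<Rightarrow> complex mat" where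
  "mat_sum n k A = mat n n (\<lambda>(a, b). \<Sum>i<k. A i $$ (a, b))"

definition unitary_mat :: "nat \<Rightarrow> complex mat \<Rightarrow> bool" where
  "unitary_mat n u \<longleftrightarrow>
     u \<in> carrier_mat n n \<and> mat_adjoint u * u = 1\<^sub>m n \<and> u * mat_adjoint u = 1\<^sub>m n"

definition surjective_mat :: "nat \<Rightarrow> nat \<Rightarrow> complex mat \<Rightarrow> bool" where
  "surjective_mat m n \<gamma> \<longleftrightarrow>
     \<gamma> \<in> carrier_mat m n \<and> (*\<^sub>v) \<gamma> ` carrier_vec n = carrier_vec m"

text \<open>
  All matrix levels are positive. The condition \<open>0 < m i\<close> cannot be dropped: a \<open>0 \<times> n\<close> matrix is
  surjective, and allowing such summands would leave no extreme points at all.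
\<close>

definition matrix_extreme ::
  "('a::complex_hilbert \<Rightarrow>\<^sub>L 'a) set \<Rightarrow> nat \<Rightarrow> (('a \<Rightarrow>\<^sub>L 'a) \<Rightarrow> complex mat) \<Rightarrow> bool" where
  "matrix_extreme S n \<phi> \<longleftrightarrow>
     0 < n \<and> \<phi> \<in> UCP S n \<and>
     (\<forall>(k::nat) m \<psi> \<gamma>.
        (\<forall>i<k. 0 < m i \<and> \<psi> i \<in> UCP S (m i) \<and> surjective_mat (m i) n (\<gamma> i)) \<and>
        mat_sum n k (\<lambda>i. mat_adjoint (\<gamma> i) * \<gamma> i) = 1\<^sub>m n \<and>
        (\<forall>A\<in>S. \<phi> A = mat_sum n k (\<lambda>i. mat_adjoint (\<gamma> i) * \<psi> i A * \<gamma> i))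
        \<longrightarrow> (\<forall>i<k. m i = n \<and>
              (\<exists>u. unitary_mat n u \<and> (\<forall>A\<in>S. \<phi> A = mat_adjoint u * \<psi> i A * u))))"

definition matrix_extreme_points ::
  "('a::complex_hilbert \<Rightarrow>\<^sub>L 'a) set \<Rightarrow> nat \<Rightarrow> (('a \<Rightarrow>\<^sub>L 'a) \<Rightarrow> complex mat) set" where
  "matrix_extreme_points S n = {\<phi>. matrix_extreme S n \<phi>}"

definition subhomogeneous :: "nat \<Rightarrow> ('a::complex_hilbert \<Rightarrow>\<^sub>L 'a) set \<Rightarrow> bool" where
  "subhomogeneous N S \<longleftrightarrow>
     0 < N \<and> (\<forall>n>N. matrix_extreme_points S n = {}) \<and>
     (\<forall>M>0. (\<forall>n>M. matrix_extreme_points S n = {}) \<longrightarrow> N \<le> M)"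

end

(*
  Composing with the vector states of S(s), it suffices that theta o phi is completely positive for
  every completely positive theta from S(s) to the n x n matrices. Since S(s) is finite-dimensional,
  these theta form a cone with a compact base, so it is enough to test the pure ones. Dividing a pure
  theta by the null space of theta(1) gives theta = gamma* psi gamma with psi unital; purity turns
  any matrix convex combination representing psi into unitary conjugates of psi, so psi is a matrix
  extreme point, of some level k <= N. Complete positivity of a map into the k x k matrices
  only requires k-positivity, which psi o phi inherits from phi.
*)

theory Submission
  imports Defs
begin

section \<open>Adjoints\<close>

text \<open>A map into matrices is encoded as one functional on matrices over S(s) of the same size.
  A scalar compression crosses the pairing as its transpose and commutes with \<open>\<phi>\<close>,
  so a form that factors through level \<open>k\<close> sees a large matrix over S(r) only through a
  \<open>k\<close> x \<open>k\<close> compression, made before \<open>\<phi>\<close> acts. This is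
  how positivity at one level handles matrices of every size. Purity need not survive composition
  with \<open>\<phi>\<close>; the reduction to pure forms therefore takes place on S(s) alone, with
  the image matrix fixed. That matrix is not yet known to be positive, so its pairing with a form
  might not be real: what is minimised is the real part of a complex multiple of the pairing, and
  the multiples 1, i and -i are used. Purity refers to rays of the cone rather than to points of the
  base, because the summands of a matrix convex combination are not unital. Proportionality to the
  whole, read at the unit, turns a surjective coefficient into a multiple of a unitary.\<close>

lemma riesz_representation:
  fixes f :: "'a::{real_inner, complete_space} \<Rightarrow> real"
  assumes "bounded_linear f"
  shows "\<exists>z. \<forall>x. f x = inner x z"
proof -
  interpret f: bounded_linear f by fact
  \<comment> \<open>Energy functional: its derivative at \<open>z\<close> in direction
    \<open>v\<close> is \<open>inner v z - f v\<close>, so a minimiser represents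
    \<open>f\<close>.\<close>
  define J where "J = (\<lambda>x. (inner x x) / 2 - f x)"
  define m where "m = Inf (range J)"
  obtain K where K: "\<And>x. norm (f x) \<le> norm x * K" "K \<ge> 0"
    using f.nonneg_bounded by blast
  have bnd: "- K\<^sup>2 / 2 \<le> J x" for x
  proof -
    have "f x \<le> norm x * K" using K(1)[of x] by simp
    moreover have "0 \<le> (norm x - K)\<^sup>2" by simp
    ultimately show ?thesis
      by (simp add: J_def power2_norm_eq_inner[symmetric] power2_diff)
  qed
  have bdd: "bdd_below (range J)" using bnd by (intro bdd_belowI[of _ "- K\<^sup>2 / 2"]) auto
  have m_le: "m \<le> J x" for x unfolding m_def by (rule cInf_lower[OF _ bdd]) simp
  have "\<exists>x. J x < m + 1 / real (Suc n)" for n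
  proof -
    have "Inf (range J) < m + 1 / real (Suc n)" by (simp add: m_def)
    then show ?thesis using cInf_lessD[of "range J"] by blast
  qed
  then obtain x where x: "\<And>n. J (x n) < m + 1 / real (Suc n)" by metis
  \<comment> \<open>Parallelogram law: a minimising sequence is Cauchy.\<close>
  have par: "(norm (a - b))\<^sup>2 / 4 = J a + J b - 2 * J ((1/2) *\<^sub>R (a + b))" for a b
    by (simp add: J_def power2_norm_eq_inner f.scaleR f.add inner_add_left inner_add_right
      inner_diff_left inner_diff_right inner_commute field_simps)
  have close: "(norm (x n - x k))\<^sup>2 \<le> 4 * (1 / real (Suc n) + 1 / real (Suc k))" for n k
    using par[of "x n" "x k"] x[of n] x[of k] m_le[of "(1/2) *\<^sub>R (x n + x k)"] by argo
  have "Cauchy x"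
  proof (rule metric_CauchyI)
    fix e :: real assume e: "0 < e"
    \<comment> \<open>With this choice the bound in \<open>close\<close> stays below 4 (e^2/8 +
      e^2/8) = e^2.\<close>
    obtain M where M: "8 / e\<^sup>2 < real M" using reals_Archimedean2 by blast
    have "dist (x n) (x k) < e" if "n \<ge> M" "k \<ge> M" for n k
    proof -
      have *: "1 / real (Suc j) < e\<^sup>2 / 8" if "j \<ge> M" for j
      proof -
        have "8 / e\<^sup>2 < real (Suc j)" using M that by linarith
        then show ?thesis using e by (simp add: field_simps)
      qed
      have "(norm (x n - x k))\<^sup>2 < e\<^sup>2"
        using close[of n k] *[OF that(1)] *[OF that(2)] by argo
      then show ?thesis using e by (simp add: dist_norm power2_less_imp_less)
    qed
    then show "\<exists>M. \<forall>n\<ge>M. \<forall>k\<ge>M. dist (x n) (x k) < e" by blast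
  qed
  then obtain z where z: "x \<longlonglongrightarrow> z"
    using Cauchy_convergent convergent_def by blast
  have "(\<lambda>n. J (x n)) \<longlonglongrightarrow> J z"
    unfolding J_def by (intro tendsto_intros z f.tendsto) simp
  moreover have "(\<lambda>n. m + 1 / real (Suc n)) \<longlonglongrightarrow> m + 0"
    by (intro tendsto_intros LIMSEQ_Suc[OF lim_1_over_n])
  ultimately have "J z \<le> m + 0"
    using x by (intro LIMSEQ_le) (auto intro: less_imp_le)
  then have min: "J z \<le> J y" for y using m_le[of y] by simp
  have "f v = inner v z" for v
  proof (rule ccontr)
    assume "f v \<noteq> inner v z"
    define c where "c = f v - inner v z"
    have c: "c \<noteq> 0" using \<open>f v \<noteq> inner v z\<close> by (simp add: c_def)
    then have v: "v \<noteq> 0" by (auto simp: c_def f.zero)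
    \<comment> \<open>Minimiser of the quadratic \<open>- t c + t^2 inner v v / 2\<close>; it would
      lower \<open>J\<close> by \<open>c^2 / (2 inner v v)\<close>.\<close>
    define t where "t = c / inner v v"
    have vv: "inner v v > 0" using v by simp
    have "J (z + t *\<^sub>R v) = J z - t * c + t\<^sup>2 * inner v v / 2"
      by (simp add: J_def c_def f.add f.scaleR inner_add_left inner_add_right inner_commute
        field_simps power2_eq_square)
    then have "t * c \<le> t\<^sup>2 * inner v v / 2" using min[of "z + t *\<^sub>R v"] by simp
    moreover have "t * c = c\<^sup>2 / inner v v" "t\<^sup>2 * inner v v = c\<^sup>2 / inner v v"
      using vv by (simp_all add: t_def power2_eq_square)
    moreover have "c\<^sup>2 / inner v v > 0" using vv c by simp
    ultimately show False by argo
  qed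
  then show ?thesis by blast
qed

lemma Im_cinner: "Im (cinner x y) = - inner (\<i> *\<^sub>C x) y"
  by (metis Re_cinner cinner_scaleC_left add.inverse_inverse Re_i_times)

lemma cinner_add_right: "cinner x (y + z) = cinner x y + cinner x z"
  by (metis cinner_add_left cinner_commute complex_cnj_add)

lemma cinner_scaleC_right: "cinner x (c *\<^sub>C y) = cnj c * cinner x y"
  by (metis cinner_scaleC_left cinner_commute complex_cnj_mult)

lemma cinner_zero_left [simp]: "cinner 0 y = 0"
  using cinner_add_left[of 0 0 y] by simp

lemma cinner_zero_right [simp]: "cinner x 0 = 0"
  using cinner_add_right[of x 0 0] by simp

lemma cinner_sum_left: "cinner (\<Sum>i\<in>I. g i) y = (\<Sum>i\<in>I. cinner (g i) y)"
  by (induction I rule: infinite_finite_induct) (simp_all add: cinner_add_left)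

lemma cinner_sum_right: "cinner x (\<Sum>i\<in>I. g i) = (\<Sum>i\<in>I. cinner x (g i))"
  by (induction I rule: infinite_finite_induct) (simp_all add: cinner_add_right)

lemma scaleC_zero_left [simp]: "0 *\<^sub>C (x::'a::complex_vector) = 0"
  using scaleC_add_left[of 0 0 x] by simp

lemma cinner_self: "cinner x x = of_real ((norm x)\<^sup>2)"
proof -
  have "Im (cinner x x) = 0"
    using cinner_commute[of x x] by (metis cnj.simps(2) neg_equal_zero)
  then show ?thesis by (simp add: complex_eq_iff Re_cinner power2_norm_eq_inner)
qed

lemma norm_cinner_le: "cmod (cinner x y) \<le> norm x * norm y"
proof (cases "cinner x y = 0")
  case False
  \<comment> \<open>This phase turns the complex inner product into its modulus, so that the real
    Cauchy-Schwarz inequality applies.\<close>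
  define u where "u = cnj (cinner x y) / cmod (cinner x y)"
  have u: "cmod u = 1" using False by (simp add: u_def norm_divide)
  have "of_real (cmod (cinner x y)) = u * cinner x y"
    using False complex_norm_square[of "cinner x y"]
    by (simp add: u_def power2_eq_square mult.commute eq_divide_eq)
  also have "\<dots> = cinner (u *\<^sub>C x) y" by (simp add: cinner_scaleC_left)
  finally have "cmod (cinner x y) = inner (u *\<^sub>C x) y" by (metis Re_cinner Re_complex_of_real)
  also have "\<dots> \<le> norm (u *\<^sub>C x) * norm y" by (rule norm_cauchy_schwarz)
  finally show ?thesis using u by (simp add: norm_scaleC)
qed simp

lemma cinner_ext: "(\<And>x. cinner x y = cinner x z) \<Longrightarrow> y = z"
  by (metis Re_cinner vector_eq_rdot inner_commute)

lemma blinfun_apply_scaleC: "blinfun_apply (c *\<^sub>C A) x = c *\<^sub>C blinfun_apply A x"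
  by (simp add: scaleC_blinfun.rep_eq)

lemma is_adjoint_unique: "is_adjoint T A \<Longrightarrow> is_adjoint T B \<Longrightarrow> A = B"
  unfolding is_adjoint_def by (intro blinfun_eqI cinner_ext) metis

lemma is_adjoint_sym: "is_adjoint T A \<Longrightarrow> is_adjoint A T"
  unfolding is_adjoint_def by (metis cinner_commute)

lemma is_adjoint_add: "is_adjoint T A \<Longrightarrow> is_adjoint U B \<Longrightarrow> is_adjoint (T + U) (A + B)"
  unfolding is_adjoint_def by (simp add: blinfun.add_left cinner_add_left cinner_add_right)

lemma is_adjoint_scaleC: "is_adjoint T A \<Longrightarrow> is_adjoint (c *\<^sub>C T) (cnj c *\<^sub>C A)"
  unfolding is_adjoint_def
  by (simp add: blinfun_apply_scaleC cinner_scaleC_left cinner_scaleC_right)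

lemma is_adjoint_id: "is_adjoint id_blinfun id_blinfun"
  by (simp add: is_adjoint_def)

text \<open>Riesz supplies an adjoint for the real inner product only. Since
  \<open>Im (cinner x y)\<close> is, up to sign, a real inner product with
  \<open>\<i> *\<^sub>C x\<close>, complex linearity of \<open>T\<close> upgrades the identity to
  \<open>cinner\<close>; uniqueness of representing vectors then makes the adjoint linear.\<close>

lemma adjoint_exists:
  fixes T :: "'a::complex_hilbert \<Rightarrow>\<^sub>L 'a"
  assumes "T \<in> bounded_operators"
  shows "\<exists>A\<in>bounded_operators. is_adjoint T A"
proof -
  have "\<exists>z. \<forall>x. inner (T x) y = inner x z" for y
    by (intro riesz_representation bounded_linear_compose[OF bounded_linear_inner_left]
      blinfun.bounded_linear_right)
  then obtain A where A: "\<And>x y. inner (T x) y = inner x (A y)" by metis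
  have TA: "cinner (T x) y = cinner x (A y)" for x y
    using assms by (simp add: complex_eq_iff Re_cinner Im_cinner A bounded_operators_def
      flip: A)
  have sc: "A (c *\<^sub>C y) = c *\<^sub>C A y" for c y
    by (rule cinner_ext) (simp add: cinner_scaleC_right flip: TA)
  have "bounded_linear A"
  proof (rule bounded_linear_intro[where K = "norm T"])
    show "A (x + y) = A x + A y" for x y
      by (rule cinner_ext) (simp add: cinner_add_right flip: TA)
    show "A (t *\<^sub>R x) = t *\<^sub>R A x" for t x
      using sc[of "of_real t"] by (simp add: scaleC_of_real)
    fix y
    have "norm (A y) * norm (A y) = inner (T (A y)) y"
      by (simp add: A norm_eq_sqrt_inner)
    also have "\<dots> \<le> norm (T (A y)) * norm y" by (rule norm_cauchy_schwarz)
    also have "\<dots> \<le> norm T * norm (A y) * norm y"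
      by (intro mult_right_mono norm_blinfun) simp
    finally have "norm (A y) * norm (A y) \<le> norm (A y) * (norm y * norm T)"
      by (simp add: ac_simps)
    then show "norm (A y) \<le> norm y * norm T"
      by (cases "norm (A y) = 0") (simp_all add: mult_le_cancel_left)
  qed
  then have "blinfun_apply (Blinfun A) = A" by (rule bounded_linear_Blinfun_apply)
  then have "Blinfun A \<in> bounded_operators" "is_adjoint T (Blinfun A)"
    by (simp_all add: bounded_operators_def is_adjoint_def sc TA)
  then show ?thesis by blast
qed

lemma operator_system_bounded_operators: "operator_system bounded_operators"
  unfolding operator_system_def
  using adjoint_exists
  by (auto simp: bounded_operators_def blinfun.add_left blinfun_apply_scaleC scaleC_add_right
    scaleC_scaleC mult.commute)

text \<open>Intersections preserve closure under adjoints because adjoints are unique: the one found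
  in a single member lies in every member. \<open>bounded_operators\<close> is itself a member, so
  the intersection is not over an empty family.\<close>

lemma operator_system_generated:
  assumes "\<forall>i<d. s i \<in> bounded_operators"
  shows "operator_system (generated_system d s)"
proof -
  let ?F = "{t. operator_system t \<and> s ` {..<d} \<subseteq> t}"
  have gen: "generated_system d s = \<Inter> ?F" by (simp add: generated_system_def hull_def)
  have mem: "bounded_operators \<in> ?F" using assms operator_system_bounded_operators by auto
  have "\<exists>B\<in>\<Inter>?F. is_adjoint A B" if A: "A \<in> \<Inter>?F" for A
  proof -
    obtain B where B: "is_adjoint A B"
      using A mem unfolding operator_system_def by blast
    have "B \<in> t" if "t \<in> ?F" for t
      using that A B is_adjoint_unique[of A B] unfolding operator_system_def by blast
    then show ?thesis using B by blast
  qed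
  moreover have "\<Inter>?F \<subseteq> bounded_operators" using mem by blast
  moreover have "id_blinfun \<in> \<Inter>?F" "\<forall>A\<in>\<Inter>?F. \<forall>B\<in>\<Inter>?F. A + B \<in> \<Inter>?F"
    "\<forall>c. \<forall>A\<in>\<Inter>?F. c *\<^sub>C A \<in> \<Inter>?F"
    unfolding operator_system_def by blast+
  ultimately show ?thesis unfolding gen operator_system_def by blast
qed

section \<open>Completely positive forms\<close>

definition complex_linear_on ::
  "('a::complex_hilbert \<Rightarrow>\<^sub>L 'a) set \<Rightarrow> (('a \<Rightarrow>\<^sub>L 'a) \<Rightarrow> complex) \<Rightarrow> bool" where
  "complex_linear_on S g \<longleftrightarrow>
     (\<forall>A\<in>S. \<forall>B\<in>S. g (A + B) = g A + g B) \<and> (\<forall>c. \<forall>A\<in>S. g (c *\<^sub>C A) = c * g A)"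

lemma operator_system_zero: "operator_system S \<Longrightarrow> 0 \<in> S"
  unfolding operator_system_def by (metis scaleC_zero_left)

lemma operator_system_sum:
  assumes "operator_system S" and "\<And>i. i \<in> I \<Longrightarrow> X i \<in> S"
  shows "(\<Sum>i\<in>I. X i) \<in> S"
  using assms(2)
proof (induction I rule: infinite_finite_induct)
  case (insert i I)
  then show ?case using assms(1) by (auto simp: operator_system_def)
qed (auto intro: operator_system_zero[OF assms(1)])

lemma complex_linear_on_zero:
  assumes "operator_system S" "complex_linear_on S g"
  shows "g 0 = 0"
proof -
  have "g (0 *\<^sub>C 0) = 0 * g 0"
    using assms operator_system_zero[OF assms(1)] unfolding complex_linear_on_def by blast
  then show ?thesis by simp
qed

lemma complex_linear_on_sum:
  assumes "operator_system S" "complex_linear_on S g" "\<And>i. i \<in> I \<Longrightarrow> X i \<in> S"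
  shows "g (\<Sum>i\<in>I. X i) = (\<Sum>i\<in>I. g (X i))"
  using assms(3)
proof (induction I rule: infinite_finite_induct)
  case (insert i I)
  have "(\<Sum>i\<in>I. X i) \<in> S" using insert by (intro operator_system_sum[OF assms(1)]) auto
  then show ?case using insert assms(2) by (auto simp: complex_linear_on_def)
qed (auto intro: complex_linear_on_zero[OF assms(1,2)])

section \<open>Scalar compressions of operator matrices and of forms\<close>

lemma sum_swap4:
  "(\<Sum>a\<in>A. \<Sum>b\<in>B. \<Sum>i\<in>I. \<Sum>j\<in>J. g a b i j) = (\<Sum>i\<in>I. \<Sum>j\<in>J. \<Sum>a\<in>A. \<Sum>b\<in>B. g a b i j)"
proof -
  have "(\<Sum>a\<in>A. \<Sum>b\<in>B. \<Sum>i\<in>I. \<Sum>j\<in>J. g a b i j) = (\<Sum>a\<in>A. \<Sum>i\<in>I. \<Sum>j\<in>J. \<Sum>b\<in>B. g a b i j)"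
    by (simp add: sum.swap[of _ _ B])
  also have "\<dots> = (\<Sum>i\<in>I. \<Sum>j\<in>J. \<Sum>a\<in>A. \<Sum>b\<in>B. g a b i j)"
    by (simp add: sum.swap[of _ _ A])
  finally show ?thesis .
qed

text \<open>This is \<open>\<alpha>* X \<alpha>\<close> for a scalar matrix with \<open>k\<close>
  rows. The number of columns is left open, so one compression can be read at several sizes.\<close>

definition op_compress ::
  "nat \<Rightarrow> (nat \<Rightarrow> nat \<Rightarrow> complex) \<Rightarrow> (nat \<Rightarrow> nat \<Rightarrow> ('a::complex_hilbert \<Rightarrow>\<^sub>L 'a))
     \<Rightarrow> nat \<Rightarrow> nat \<Rightarrow> ('a \<Rightarrow>\<^sub>L 'a)" where
  "op_compress k \<alpha> X = (\<lambda>a b. \<Sum>i<k. \<Sum>j<k. (cnj (\<alpha> i a) * \<alpha> j b) *\<^sub>C X i j)"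

lemma op_compress_mem:
  assumes "operator_system S" "\<forall>i<k. \<forall>j<k. X i j \<in> S"
  shows "op_compress k \<alpha> X a b \<in> S"
proof -
  have "c *\<^sub>C A \<in> S" if "A \<in> S" for c A
    using that assms(1) by (simp add: operator_system_def)
  then show ?thesis
    unfolding op_compress_def using assms(2) by (intro operator_system_sum[OF assms(1)]) auto
qed

lemma bounded_operators_sum:
  assumes "T \<in> bounded_operators"
  shows "blinfun_apply T (\<Sum>i\<in>I. c i *\<^sub>C x i) = (\<Sum>i\<in>I. c i *\<^sub>C blinfun_apply T (x i))"
  using assms by (simp add: blinfun.sum_right bounded_operators_def)

text \<open>Its quadratic form at \<open>h\<close> is that of \<open>X\<close> at
  \<open>\<alpha> h\<close>, the tuple \<open>g\<close> below. Pulling the scalars through the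
  entries uses their complex linearity.\<close>

lemma positive_op_compress:
  fixes X :: "nat \<Rightarrow> nat \<Rightarrow> ('a::complex_hilbert \<Rightarrow>\<^sub>L 'a)"
  assumes X: "\<forall>i<k. \<forall>j<k. X i j \<in> bounded_operators" and pos: "positive_op_matrix k X"
  shows "positive_op_matrix n (op_compress k \<alpha> X)"
  unfolding positive_op_matrix_def
proof
  fix h :: "nat \<Rightarrow> 'a"
  define g where "g = (\<lambda>j. \<Sum>b<n. \<alpha> j b *\<^sub>C h b)"
  have X': "cinner (X i j (g j)) (g i)
      = (\<Sum>a<n. \<Sum>b<n. cnj (\<alpha> i a) * \<alpha> j b * cinner (X i j (h b)) (h a))"
    if "i < k" "j < k" for i j
    using X that
    by (simp add: g_def bounded_operators_sum cinner_sum_left cinner_sum_right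
      cinner_scaleC_left cinner_scaleC_right sum_distrib_left mult.assoc)
  have "(\<Sum>a<n. \<Sum>b<n. cinner (op_compress k \<alpha> X a b (h b)) (h a))
      = (\<Sum>a<n. \<Sum>b<n. \<Sum>i<k. \<Sum>j<k. cnj (\<alpha> i a) * \<alpha> j b * cinner (X i j (h b)) (h a))"
    by (simp add: op_compress_def blinfun.sum_left blinfun_apply_scaleC cinner_sum_left
      cinner_scaleC_left)
  also have "\<dots> = (\<Sum>i<k. \<Sum>j<k. cinner (X i j (g j)) (g i))"
    by (subst sum_swap4) (simp add: X')
  finally show "0 \<le> (\<Sum>a<n. \<Sum>b<n. cinner (op_compress k \<alpha> X a b (h b)) (h a))"
    using pos by (simp add: positive_op_matrix_def)
qed

text \<open>
  A form \<open>f\<close> at level \<open>n\<close> encodes the map \<open>A \<mapsto> (f (A, a, b))\<close> into the \<open>n \<times> n\<close> matrices.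
  Testing positivity only on \<open>n \<times> n\<close> matrices over \<open>S\<close> and only against the standard
  basis suffices for complete positivity, see \<open>cp_form_amplified\<close>.
\<close>

definition pairing :: "nat \<Rightarrow> ('x \<times> nat \<times> nat \<Rightarrow> complex) \<Rightarrow> (nat \<Rightarrow> nat \<Rightarrow> 'x) \<Rightarrow> complex" where
  "pairing n f X = (\<Sum>a<n. \<Sum>b<n. f (X a b, a, b))"

definition linear_form ::
  "('a::complex_hilbert \<Rightarrow>\<^sub>L 'a) set \<Rightarrow> nat \<Rightarrow> (('a \<Rightarrow>\<^sub>L 'a) \<times> nat \<times> nat \<Rightarrow> complex) \<Rightarrow> bool" where
  "linear_form S n f \<longleftrightarrow> (\<forall>a<n. \<forall>b<n. complex_linear_on S (\<lambda>A. f (A, a, b)))"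

definition cp_form ::
  "('a::complex_hilbert \<Rightarrow>\<^sub>L 'a) set \<Rightarrow> nat \<Rightarrow> (('a \<Rightarrow>\<^sub>L 'a) \<times> nat \<times> nat \<Rightarrow> complex) \<Rightarrow> bool" where
  "cp_form S n f \<longleftrightarrow> linear_form S n f \<and>
     (\<forall>X. (\<forall>a<n. \<forall>b<n. X a b \<in> S) \<and> positive_op_matrix n X \<longrightarrow> 0 \<le> pairing n f X)"

text \<open>In terms of the matrix-valued map \<open>F\<close> encoded by \<open>f\<close>, this is
  \<open>A \<mapsto> G* F(A) G\<close>; the column count of \<open>G\<close> is again open.\<close>

definition form_compress ::
  "nat \<Rightarrow> (nat \<Rightarrow> nat \<Rightarrow> complex) \<Rightarrow> ('x \<times> nat \<times> nat \<Rightarrow> complex) \<Rightarrow> ('x \<times> nat \<times> nat \<Rightarrow> complex)"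
  where
  "form_compress n G f = (\<lambda>(A, c, d). \<Sum>a<n. \<Sum>b<n. cnj (G a c) * f (A, a, b) * G b d)"

lemma linear_form_compress:
  assumes "linear_form S n f"
  shows "linear_form S m (form_compress n G f)"
proof -
  have "f (A + B, a, b) = f (A, a, b) + f (B, a, b)" "f (c *\<^sub>C A, a, b) = c * f (A, a, b)"
    if "a < n" "b < n" "A \<in> S" "B \<in> S" for A B a b c
    using assms that by (auto simp: linear_form_def complex_linear_on_def)
  then show ?thesis
    by (simp add: linear_form_def complex_linear_on_def form_compress_def sum.distrib
      sum_distrib_left distrib_left distrib_right mult_ac)
qed

text \<open>\<open>G\<close> acts on the indices of the form, its transpose on those of
  \<open>X\<close>; both sides expand to the same fourfold sum. This exchanges a test matrix of size
  \<open>m\<close> for one of size \<open>n\<close>.\<close>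

lemma pairing_compress:
  assumes S: "operator_system S" and f: "linear_form S n f" and X: "\<forall>i<m. \<forall>j<m. X i j \<in> S"
  shows "pairing m (form_compress n G f) X = pairing n f (op_compress m (\<lambda>c a. G a c) X)"
proof -
  have mem: "c *\<^sub>C A \<in> S" if "A \<in> S" for c A
    using that S by (simp add: operator_system_def)
  have lin: "complex_linear_on S (\<lambda>A. f (A, a, b))" if "a < n" "b < n" for a b
    using f that by (simp add: linear_form_def)
  have "f (op_compress m (\<lambda>c a. G a c) X a b, a, b)
      = (\<Sum>c<m. \<Sum>d<m. cnj (G a c) * f (X c d, a, b) * G b d)" if ab: "a < n" "b < n" for a b
  proof -
    have "f (op_compress m (\<lambda>c a. G a c) X a b, a, b)
        = (\<Sum>c<m. \<Sum>d<m. f ((cnj (G a c) * G b d) *\<^sub>C X c d, a, b))"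
      unfolding op_compress_def
      by (subst complex_linear_on_sum[OF S lin[OF ab]], use X mem in
        \<open>auto intro!: operator_system_sum[OF S] sum.cong complex_linear_on_sum[OF S lin[OF ab]]\<close>)
    also have "\<dots> = (\<Sum>c<m. \<Sum>d<m. cnj (G a c) * f (X c d, a, b) * G b d)"
      using lin[OF ab] X by (intro sum.cong) (auto simp: complex_linear_on_def)
    finally show ?thesis .
  qed
  then show ?thesis
    unfolding pairing_def by (simp add: form_compress_def) (rule sum_swap4)
qed

text \<open>Here positivity of one functional on \<open>n\<close> x \<open>n\<close> matrices
  becomes complete positivity: with test vectors as the columns of \<open>G\<close>, every quadratic
  form of the amplified map is such a pairing, and the transpose of \<open>G\<close> carries
  \<open>X\<close> to size \<open>n\<close>.\<close>

lemma cp_form_amplified: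
  assumes S: "operator_system S" and f: "cp_form S n f"
    and X: "\<forall>i<m. \<forall>j<m. X i j \<in> S" "positive_op_matrix m X"
  shows "0 \<le> pairing m (form_compress n G f) X"
proof -
  have "\<forall>i<m. \<forall>j<m. X i j \<in> bounded_operators"
    using X(1) S by (auto simp: operator_system_def)
  then have "positive_op_matrix n (op_compress m (\<lambda>c a. G a c) X)"
    by (rule positive_op_compress[OF _ X(2)])
  moreover have "op_compress m (\<lambda>c a. G a c) X a b \<in> S" for a b
    by (rule op_compress_mem[OF S X(1)])
  ultimately have "0 \<le> pairing n f (op_compress m (\<lambda>c a. G a c) X)"
    using f by (simp add: cp_form_def)
  then show ?thesis
    using pairing_compress[OF S _ X(1), of n f] f by (simp add: cp_form_def)
qed

lemma cp_form_compress:
  assumes "operator_system S" "cp_form S n f"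
  shows "cp_form S m (form_compress n G f)"
  using assms linear_form_compress[of S n f m G] cp_form_amplified[OF assms, of m]
  unfolding cp_form_def[of S m] by (simp add: cp_form_def)

section \<open>Control of a form by its value at the unit\<close>

lemma cp_form_unit_nonneg:
  assumes S: "operator_system S" and f: "cp_form S n f"
  shows "0 \<le> (\<Sum>a<n. \<Sum>b<n. cnj (v a) * f (id_blinfun, a, b) * v b)"
proof -
  have "positive_op_matrix 1 (\<lambda>_ _. id_blinfun :: 'a \<Rightarrow>\<^sub>L 'a)"
    by (simp add: positive_op_matrix_def cinner_self less_eq_complex_def)
  moreover have "id_blinfun \<in> S" using S by (simp add: operator_system_def)
  ultimately have "0 \<le> pairing 1 (form_compress n (\<lambda>a _. v a) f) (\<lambda>_ _. id_blinfun)"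
    using cp_form_amplified[OF S f, of 1] by simp
  then show ?thesis by (simp add: pairing_def form_compress_def)
qed

text \<open>The matrix with diagonal \<open>norm A\<close> and off-diagonal entries
  \<open>z A\<close> and \<open>cnj z A*\<close> is positive for every phase \<open>z\<close>.
  Pairing gives \<open>w + 2 Re (z p) \<ge> 0\<close>, and the best phase is the one with
  \<open>z p = - cmod p\<close>.\<close>

lemma cp_form_bound2:
  assumes S: "operator_system S" and f: "cp_form S 2 f" and A: "A \<in> S"
  shows "cmod (f (A, 0, 1)) \<le>
    norm A * (Re (f (id_blinfun, 0, 0)) + Re (f (id_blinfun, 1, 1))) / 2"
proof -
  obtain B where B: "B \<in> S" "is_adjoint A B"
    using S A unfolding operator_system_def by blast
  have B': "cinner (B x) y = cnj (cinner (A y) x)" for x y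
    using B(2) cinner_commute[of "B x" y] by (simp add: is_adjoint_def)
  have I: "id_blinfun \<in> S" using S by (simp add: operator_system_def)
  have mem: "c *\<^sub>C T \<in> S" if "T \<in> S" for c T
    using that S by (simp add: operator_system_def)
  have f_scale: "f (c *\<^sub>C T, a, b) = c * f (T, a, b)" if "a < 2" "b < 2" "T \<in> S" for a b c T
    using f that unfolding cp_form_def linear_form_def complex_linear_on_def by blast
  define p where "p = f (A, 0, 1)"
  define q where "q = f (B, 1, 0)"
  define w where "w = of_real (norm A) * (f (id_blinfun, 0, 0) + f (id_blinfun, 1, 1))"
  have key: "0 \<le> w + z * p + cnj z * q" if z: "cmod z = 1" for z
  proof -
    define X where "X = (\<lambda>i j :: nat. if i = j then of_real (norm A) *\<^sub>C id_blinfun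
      else if i = 0 then z *\<^sub>C A else cnj z *\<^sub>C B)"
    have "positive_op_matrix 2 X"
      unfolding positive_op_matrix_def
    proof
      fix h :: "nat \<Rightarrow> 'a"
      define u where "u = cinner (A (h 1)) (h 0)"
      have "cmod (z * u) \<le> norm (A (h 1)) * norm (h 0)"
        using z norm_cinner_le[of "A (h 1)" "h 0"] by (simp add: norm_mult u_def)
      also have "\<dots> \<le> norm A * (norm (h 1) * norm (h 0))"
        using mult_right_mono[OF norm_blinfun[of A "h 1"], of "norm (h 0)"] by (simp add: mult.assoc)
      finally have "- Re (z * u) \<le> norm A * (norm (h 1) * norm (h 0))"
        using abs_Re_le_cmod[of "z * u"] by linarith
      moreover have "0 \<le> norm A * (norm (h 1) - norm (h 0))\<^sup>2" by simp
      ultimately have ge: "0 \<le> norm A * ((norm (h 0))\<^sup>2 + (norm (h 1))\<^sup>2) + 2 * Re (z * u)"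
        by (simp add: power2_diff algebra_simps)
      have "(\<Sum>i<2. \<Sum>j<2. cinner (X i j (h j)) (h i))
          = of_real (norm A * ((norm (h 0))\<^sup>2 + (norm (h 1))\<^sup>2)) + z * u + cnj (z * u)"
        by (simp add: numeral_2_eq_2 X_def blinfun_apply_scaleC cinner_scaleC_left B' cinner_self
          u_def algebra_simps)
      then show "0 \<le> (\<Sum>i<2. \<Sum>j<2. cinner (X i j (h j)) (h i))"
        using ge by (simp add: less_eq_complex_def algebra_simps)
    qed
    moreover have "\<forall>i<2. \<forall>j<2. X i j \<in> S" using I A B mem by (simp add: X_def)
    ultimately have "0 \<le> pairing 2 f X" using f by (simp add: cp_form_def)
    also have "pairing 2 f X = w + z * p + cnj z * q"
      using f_scale[of 0 0] f_scale[of 0 1] f_scale[of 1 0] f_scale[of 1 1] I A B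
      by (simp add: pairing_def numeral_2_eq_2 X_def p_def q_def w_def algebra_simps)
    finally show ?thesis .
  qed
  \<comment> \<open>The phases \<open>1\<close>, \<open>-1\<close> and \<open>\<i>\<close> show that \<open>f\<close> is hermitian.\<close>
  have "Im w + Im p + Im q = 0" "Im w - Im p - Im q = 0" "Im w + Re p - Re q = 0"
    using key[of 1] key[of "-1"] key[of \<i>] by (simp_all add: less_eq_complex_def)
  then have q: "q = cnj p" by (simp add: complex_eq_iff)
  have "2 * cmod p \<le> Re w"
  proof (cases "p = 0")
    case True
    then show ?thesis using key[of 1] q by (simp add: less_eq_complex_def)
  next
    case False
    define z where "z = - cnj p / cmod p"
    have z: "cmod z = 1" using False by (simp add: z_def norm_divide)
    have "z * p = - of_real (cmod p)"
      using False complex_norm_square[of p]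
      by (simp add: z_def power2_eq_square mult.commute divide_eq_eq)
    moreover from this have "cnj z * q = - of_real (cmod p)"
      by (metis q complex_cnj_mult complex_cnj_minus complex_cnj_complex_of_real)
    ultimately show ?thesis using key[OF z] by (simp add: less_eq_complex_def)
  qed
  then show ?thesis by (simp add: w_def p_def)
qed

text \<open>The \<open>n\<close> x 2 matrix with columns \<open>v\<close> and \<open>w\<close>
  compresses \<open>f\<close> to level 2.\<close>

lemma cp_form_bound:
  assumes S: "operator_system S" and f: "cp_form S n f" and A: "A \<in> S"
  shows "cmod (\<Sum>a<n. \<Sum>b<n. cnj (v a) * f (A, a, b) * w b) \<le>
    norm A * (Re (\<Sum>a<n. \<Sum>b<n. cnj (v a) * f (id_blinfun, a, b) * v b) +
              Re (\<Sum>a<n. \<Sum>b<n. cnj (w a) * f (id_blinfun, a, b) * w b)) / 2"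
  using cp_form_bound2[OF S cp_form_compress[OF S f, where G = "\<lambda>a c. if c = 0 then v a else w a"] A]
  by (simp add: form_compress_def)

text \<open>Replacing \<open>v\<close> by \<open>t v\<close> makes the left side of
  \<open>cp_form_bound\<close> of order \<open>t\<close> and the right side of order
  \<open>t^2\<close>, because \<open>w\<close> contributes nothing to it; small \<open>t\<close>
  forces zero. Null vectors at the unit are thus null for the whole form, which lets it descend to a
  quotient.\<close>

lemma cp_form_unit_null:
  assumes S: "operator_system S" and f: "cp_form S n f" and A: "A \<in> S"
    and null: "(\<Sum>a<n. \<Sum>b<n. cnj (w a) * f (id_blinfun, a, b) * w b) = 0"
  shows "(\<Sum>a<n. \<Sum>b<n. cnj (v a) * f (A, a, b) * w b) = 0"
    and "(\<Sum>a<n. \<Sum>b<n. cnj (w a) * f (A, a, b) * v b) = 0"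
proof -
  let ?F = "\<lambda>T v w. \<Sum>a<n. \<Sum>b<n. cnj (v a) * f (T, a, b) * w b"
  define K where "K = norm A * Re (?F id_blinfun v v) / 2"
  have zero: "x = 0" if le: "\<And>t. t > 0 \<Longrightarrow> t * cmod x \<le> t\<^sup>2 * K" for x
  proof (rule ccontr)
    assume "x \<noteq> 0"
    then have x: "cmod x > 0" by simp
    \<comment> \<open>The value \<open>t = 1\<close> shows \<open>K > 0\<close>; half of the
      critical value \<open>cmod x / K\<close> then violates the inequality.\<close>
    have "cmod x \<le> K" using le[of 1] by simp
    with x have K: "K > 0" by linarith
    show False using le[of "cmod x / K / 2"] x K by (simp add: power2_eq_square field_simps)
  qed
  have scaled: "?F T (\<lambda>a. of_real t * v a) w = of_real t * ?F T v w"
    "?F T w (\<lambda>a. of_real t * v a) = of_real t * ?F T w v"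
    "?F T (\<lambda>a. of_real t * v a) (\<lambda>a. of_real t * v a) = of_real (t\<^sup>2) * ?F T v v" for t T
    by (simp_all add: sum_distrib_left power2_eq_square mult_ac)
  show "?F A v w = 0"
  proof (rule zero)
    show "t * cmod (?F A v w) \<le> t\<^sup>2 * K" if "t > 0" for t
      using cp_form_bound[OF S f A, of "\<lambda>a. of_real t * v a" w] that
      unfolding scaled null K_def norm_mult by (simp add: mult_ac del: Re_sum)
  qed
  show "?F A w v = 0"
  proof (rule zero)
    show "t * cmod (?F A w v) \<le> t\<^sup>2 * K" if "t > 0" for t
      using cp_form_bound[OF S f A, of w "\<lambda>a. of_real t * v a"] that
      unfolding scaled null K_def norm_mult by (simp add: mult_ac del: Re_sum)
  qed
qed

section \<open>Existence of pure forms\<close>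

text \<open>Finite dimension enters in this dual form, with the unit, the generators and their
  adjoints as the finite set. The elements on which vanishing is forced make up an operator system
  containing the generators, hence exhaust \<open>S\<close>.\<close>

lemma generated_system_determined:
  assumes s: "\<forall>i<d. s i \<in> bounded_operators"
  defines "S \<equiv> generated_system d s"
  shows "\<exists>G. finite G \<and> G \<subseteq> S \<and>
    (\<forall>g. complex_linear_on S g \<and> (\<forall>A\<in>G. g A = 0) \<longrightarrow> (\<forall>A\<in>S. g A = 0))"
proof -
  have S: "operator_system S" unfolding S_def by (rule operator_system_generated[OF s])
  have sub: "s ` {..<d} \<subseteq> S" unfolding S_def generated_system_def by (rule hull_subset)
  have "\<forall>A\<in>S. \<exists>B\<in>S. is_adjoint A B" using S by (simp add: operator_system_def)
  then obtain star where star: "\<And>A. A \<in> S \<Longrightarrow> star A \<in> S" "\<And>A. A \<in> S \<Longrightarrow> is_adjoint A (star A)"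
    by metis
  have star_eq: "star A = B" if "A \<in> S" "is_adjoint A B" for A B
    using is_adjoint_unique star(2) that by blast
  have star_star: "star (star A) = A" if "A \<in> S" for A
    using star_eq[OF star(1) is_adjoint_sym[OF star(2)]] that by blast
  have Sadd: "A + B \<in> S" and Sscale: "c *\<^sub>C A \<in> S" if "A \<in> S" "B \<in> S" for A B c
    using S that by (auto simp: operator_system_def)
  have I: "id_blinfun \<in> S" using S by (simp add: operator_system_def)
  define G where "G = insert id_blinfun (s ` {..<d} \<union> star ` s ` {..<d})"
  have G: "G \<subseteq> S" using sub star I by (auto simp: G_def)
  have starG: "star A \<in> G" if "A \<in> G" for A
  proof -
    have "star id_blinfun = id_blinfun" using I is_adjoint_id by (rule star_eq)
    then show ?thesis using that sub star_star by (auto simp: G_def)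
  qed
  \<comment> \<open>The double annihilator of \<open>G\<close>, standing in for its span.\<close>
  define T where
    "T = {A\<in>S. \<forall>g. complex_linear_on S g \<and> (\<forall>A\<in>G. g A = 0) \<longrightarrow> g A = 0}"
  have T_D: "g A = 0" if "A \<in> T" "complex_linear_on S g" "\<forall>A\<in>G. g A = 0" for A g
    using that by (simp add: T_def)
  have star_T: "star A \<in> T" if A: "A \<in> T" for A
  proof -
    have "g (star A) = 0" if g: "complex_linear_on S g" "\<forall>A\<in>G. g A = 0" for g
    proof -
      have "star (A + B) = star A + star B" "star (c *\<^sub>C A) = cnj c *\<^sub>C star A"
        if "A \<in> S" "B \<in> S" for A B c
        using that star Sadd Sscale by (auto intro!: star_eq is_adjoint_add is_adjoint_scaleC)
      \<comment> \<open>Conjugating both the argument and the value restores complex linearity;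
        vanishing on \<open>G\<close> is kept because \<open>G\<close> is closed under
        adjoints.\<close>
      then have "complex_linear_on S (\<lambda>A. cnj (g (star A)))"
        using g(1) star(1) by (simp add: complex_linear_on_def)
      moreover have "\<forall>A\<in>G. cnj (g (star A)) = 0" using g(2) starG by simp
      ultimately have "cnj (g (star A)) = 0" by (rule T_D[OF A])
      then show ?thesis by simp
    qed
    then show ?thesis using A star(1) by (simp add: T_def)
  qed
  have TS: "T \<subseteq> S" by (auto simp: T_def)
  have IT: "id_blinfun \<in> T" using I by (simp add: T_def G_def)
  have T_add: "A + B \<in> T" and T_scale: "c *\<^sub>C A \<in> T" if AB: "A \<in> T" "B \<in> T" for A B c
  proof -
    have S: "A \<in> S" "B \<in> S" using AB by (auto simp: T_def)
    have "g (A + B) = 0 \<and> g (c *\<^sub>C A) = 0"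
      if g: "complex_linear_on S g" "\<forall>A\<in>G. g A = 0" for g
    proof -
      have "g (A + B) = g A + g B" "g (c *\<^sub>C A) = c * g A"
        using g(1) S by (auto simp: complex_linear_on_def)
      then show ?thesis using T_D[OF AB(1) g] T_D[OF AB(2) g] by simp
    qed
    then show "A + B \<in> T" "c *\<^sub>C A \<in> T" using S by (auto simp: T_def Sadd Sscale)
  qed
  have "\<exists>B\<in>T. is_adjoint A B" if "A \<in> T" for A
    using star_T[OF that] star(2)[of A] that TS by blast
  moreover have "T \<subseteq> bounded_operators" using TS S unfolding operator_system_def by blast
  ultimately have "operator_system T"
    using IT T_add T_scale unfolding operator_system_def by simp
  moreover have "s ` {..<d} \<subseteq> T" using sub by (auto simp: T_def G_def)
  ultimately have "S \<subseteq> T" unfolding S_def generated_system_def by (intro hull_minimal)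
  then show ?thesis using G by (intro exI[of _ G]) (auto simp: T_def G_def)
qed

section \<open>The cone of forms and its compact base\<close>

lemma cp_form_scale:
  assumes "cp_form S n f" "0 \<le> r"
  shows "cp_form S n (\<lambda>x. of_real r * f x)"
proof -
  have "0 \<le> complex_of_real r * z" if "0 \<le> z" for z
    using that assms(2) by (simp add: less_eq_complex_def)
  then show ?thesis
    using assms(1) unfolding cp_form_def linear_form_def complex_linear_on_def pairing_def
    by (simp add: distrib_left mult.left_commute flip: sum_distrib_left)
qed

lemma cp_form_cong:
  assumes "operator_system S" "cp_form S n f"
    and "\<And>A a b. A \<in> S \<Longrightarrow> a < n \<Longrightarrow> b < n \<Longrightarrow> f (A, a, b) = g (A, a, b)"
  shows "cp_form S n g"
proof -
  have "A + B \<in> S" "c *\<^sub>C A \<in> S" if "A \<in> S" "B \<in> S" for A B c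
    using assms(1) that by (auto simp: operator_system_def)
  then show ?thesis
    using assms(2) assms(3)[symmetric]
    unfolding cp_form_def linear_form_def complex_linear_on_def pairing_def by simp
qed

text \<open>Trace one at the unit cuts a base out of the cone. Values at irrelevant indices are set
  to 0, since free values there would destroy compactness.\<close>

definition cp_base ::
  "('a::complex_hilbert \<Rightarrow>\<^sub>L 'a) set \<Rightarrow> nat \<Rightarrow> (('a \<Rightarrow>\<^sub>L 'a) \<times> nat \<times> nat \<Rightarrow> complex) set" where
  "cp_base S n = {f. cp_form S n f \<and> (\<forall>A a b. \<not> (A \<in> S \<and> a < n \<and> b < n) \<longrightarrow> f (A, a, b) = 0) \<and>
     (\<Sum>a<n. f (id_blinfun, a, a)) = 1}"

lemma cp_form_diag_nonneg:
  assumes S: "operator_system S" and f: "cp_form S n f" and a: "a < n"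
  shows "0 \<le> f (id_blinfun, a, a)"
  using cp_form_unit_nonneg[OF S f, of "\<lambda>i. if i = a then 1 else 0"] a
  by (simp add: if_distrib[of cnj] if_distribR if_distrib[of "\<lambda>x. x * _"] if_distrib[of "\<lambda>x. _ * x"]
    sum.delta cong: if_cong)

text \<open>Diagonal values at the unit are nonnegative, so each is at most the trace. Consequently
  trace 0 forces a form to vanish on \<open>S\<close>, and trace 1 bounds its values by
  \<open>norm A\<close>.\<close>

lemma cp_form_trace_bound:
  assumes S: "operator_system S" and f: "cp_form S n f" and A: "A \<in> S" and ab: "a < n" "b < n"
  shows "cmod (f (A, a, b)) \<le> norm A * Re (\<Sum>a<n. f (id_blinfun, a, a))"
proof -
  have le: "Re (f (id_blinfun, c, c)) \<le> Re (\<Sum>a<n. f (id_blinfun, a, a))" if "c < n" for c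
    using cp_form_diag_nonneg[OF S f] that
    by (simp add: less_eq_complex_def) (rule member_le_sum, auto)
  have "cmod (f (A, a, b)) \<le> norm A * (Re (f (id_blinfun, a, a)) + Re (f (id_blinfun, b, b))) / 2"
    using cp_form_bound[OF S f A, of "\<lambda>i. if i = a then 1 else 0" "\<lambda>i. if i = b then 1 else 0"] ab
    by (simp add: if_distrib[of cnj] if_distribR if_distrib[of "\<lambda>x. x * _"]
      if_distrib[of "\<lambda>x. _ * x"] sum.delta cong: if_cong)
  also have "\<dots> \<le> norm A * Re (\<Sum>a<n. f (id_blinfun, a, a))"
    using mult_left_mono[OF add_mono[OF le[OF ab(1)] le[OF ab(2)]], of "norm A"] by simp
  finally show ?thesis .
qed

text \<open>Tychonoff: the base lies in a product of discs of radius \<open>norm A\<close>, and each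
  of its defining conditions is closed because it involves finitely many coordinates.\<close>

lemma compact_cp_base:
  fixes S :: "('a::complex_hilbert \<Rightarrow>\<^sub>L 'a) set"
  assumes S: "operator_system S"
  shows "compact (cp_base S n)"
proof -
  define D where "D = (PiE UNIV (\<lambda>x :: ('a \<Rightarrow>\<^sub>L 'a) \<times> nat \<times> nat. cball (0::complex) (norm (fst x))))"
  have "compactin (product_topology (\<lambda>_. euclidean) UNIV) D"
    unfolding D_def compactin_PiE by simp
  then have "compact D" by (simp add: euclidean_product_topology)
  moreover have "cp_base S n \<subseteq> D"
  proof
    fix f assume f: "f \<in> cp_base S n"
    have "cmod (f (A, a, b)) \<le> norm A" for A a b
    proof (cases "A \<in> S \<and> a < n \<and> b < n")
      case True
      then show ?thesis using cp_form_trace_bound[OF S, of n f A a b] f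
        by (simp add: cp_base_def del: Re_sum)
    next
      case False
      then show ?thesis using f by (auto simp: cp_base_def)
    qed
    then show "f \<in> D" by (auto simp: D_def)
  qed
  moreover have "closed (cp_base S n)"
  proof -
    have imp: "closed {x. P \<longrightarrow> Q x}" if "P \<Longrightarrow> closed {x. Q x}"
      for P and Q :: "(('a \<Rightarrow>\<^sub>L 'a) \<times> nat \<times> nat \<Rightarrow> complex) \<Rightarrow> bool"
      using that by (cases P) auto
    have "closed {f :: ('a \<Rightarrow>\<^sub>L 'a) \<times> nat \<times> nat \<Rightarrow> complex. 0 \<le> pairing n f X}" for X
      unfolding less_eq_complex_def pairing_def
      by (intro closed_Collect_conj closed_Collect_le closed_Collect_eq continuous_intros
        continuous_on_product_coordinates)
    then show ?thesis
      unfolding cp_base_def cp_form_def linear_form_def complex_linear_on_def Ball_def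
      by (intro closed_Collect_conj closed_Collect_all imp closed_Collect_eq continuous_intros
        continuous_on_product_coordinates)
  qed
  ultimately show ?thesis by (metis closed_Int_compact inf.absorb1)
qed

text \<open>Extremality of a ray of the cone, with forms compared only at the indices that carry
  information. It applies to summands of arbitrary trace.\<close>

definition pure_form ::
  "('a::complex_hilbert \<Rightarrow>\<^sub>L 'a) set \<Rightarrow> nat \<Rightarrow> (('a \<Rightarrow>\<^sub>L 'a) \<times> nat \<times> nat \<Rightarrow> complex) \<Rightarrow> bool" where
  "pure_form S n f \<longleftrightarrow> cp_form S n f \<and>
     (\<forall>f1 f2. cp_form S n f1 \<and> cp_form S n f2 \<and>
        (\<forall>A\<in>S. \<forall>a<n. \<forall>b<n. f (A, a, b) = f1 (A, a, b) + f2 (A, a, b)) \<longrightarrow>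
        (\<exists>t\<ge>0. \<forall>A\<in>S. \<forall>a<n. \<forall>b<n. f1 (A, a, b) = of_real t * f (A, a, b)))"

text \<open>Strict convexity of the squared modulus with its exact gap; at a maximiser this gap will
  have to vanish.\<close>

lemma cmod_convex_combination:
  "(cmod (of_real t * x + of_real (1 - t) * y))\<^sup>2
    = t * (cmod x)\<^sup>2 + (1 - t) * (cmod y)\<^sup>2 - t * (1 - t) * (cmod (x - y))\<^sup>2"
  unfolding cmod_power2 by (simp add: power2_eq_square algebra_simps)

lemma sum_cmod_convex_combination:
  fixes g h :: "'x \<times> nat \<times> nat \<Rightarrow> complex"
  shows "(\<Sum>A\<in>G. \<Sum>a<n. \<Sum>b<n. (cmod (of_real t * g (A, a, b) + of_real (1 - t) * h (A, a, b)))\<^sup>2)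
    = t * (\<Sum>A\<in>G. \<Sum>a<n. \<Sum>b<n. (cmod (g (A, a, b)))\<^sup>2)
      + (1 - t) * (\<Sum>A\<in>G. \<Sum>a<n. \<Sum>b<n. (cmod (h (A, a, b)))\<^sup>2)
      - t * (1 - t) * (\<Sum>A\<in>G. \<Sum>a<n. \<Sum>b<n. (cmod (g (A, a, b) - h (A, a, b)))\<^sup>2)"
  unfolding cmod_convex_combination by (simp only: sum.distrib sum_subtractf sum_distrib_left)

lemma Re_pairing_combination:
  "Re (c * pairing n (\<lambda>x. of_real t * g x + of_real u * h x) Y)
    = t * Re (c * pairing n g Y) + u * Re (c * pairing n h Y)"
proof -
  have "pairing n (\<lambda>x. of_real t * g x + of_real u * h x) Y
      = of_real t * pairing n g Y + of_real u * pairing n h Y"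
    unfolding pairing_def by (simp only: sum.distrib sum_distrib_left)
  then show ?thesis by (simp add: algebra_simps)
qed

definition normalised_form ::
  "('a::complex_hilbert \<Rightarrow>\<^sub>L 'a) set \<Rightarrow> nat \<Rightarrow> real \<Rightarrow>
     (('a \<Rightarrow>\<^sub>L 'a) \<times> nat \<times> nat \<Rightarrow> complex) \<Rightarrow> (('a \<Rightarrow>\<^sub>L 'a) \<times> nat \<times> nat \<Rightarrow> complex)" where
  "normalised_form S n r g = (\<lambda>(A, a, b). if A \<in> S \<and> a < n \<and> b < n
     then of_real (1 / r) * g (A, a, b) else 0)"

lemma normalised_form_base:
  assumes S: "operator_system S" and g: "cp_form S n g" and r: "r > 0"
    and tr: "(\<Sum>a<n. g (id_blinfun, a, a)) = of_real r"
  shows "normalised_form S n r g \<in> cp_base S n"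
proof -
  have I: "id_blinfun \<in> S" using S by (simp add: operator_system_def)
  have "cp_form S n (normalised_form S n r g)"
    by (rule cp_form_cong[OF S cp_form_scale[OF g, of "1 / r"]])
      (use r in \<open>simp_all add: normalised_form_def\<close>)
  moreover have "(\<Sum>a<n. normalised_form S n r g (id_blinfun, a, a)) = 1"
    using r tr I by (simp add: normalised_form_def flip: sum_divide_distrib)
  ultimately show ?thesis by (auto simp: cp_base_def normalised_form_def)
qed

text \<open>
  Among the minimisers of a linear functional on the compact base, a maximiser of a strictly
  convex function is an extreme point; this replaces the Krein-Milman theorem.
\<close>

lemma exists_pure_form:
  fixes S :: "('a::complex_hilbert \<Rightarrow>\<^sub>L 'a) set"
  assumes S: "operator_system S"
    and G: "finite G" "G \<subseteq> S"
      "\<And>g. complex_linear_on S g \<Longrightarrow> \<forall>A\<in>G. g A = 0 \<Longrightarrow> \<forall>A\<in>S. g A = 0"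
    and f0: "f0 \<in> cp_base S n"
  shows "\<exists>f\<in>cp_base S n. pure_form S n f \<and> Re (c * pairing n f Y) \<le> Re (c * pairing n f0 Y)"
proof -
  let ?K = "cp_base S n"
  \<comment> \<open>The factor \<open>c\<close> lets one statement serve the real part and both
    signs of the imaginary part of the pairing.\<close>
  define l where "l = (\<lambda>f. Re (c * pairing n f Y))"
  define Q where "Q = (\<lambda>f. \<Sum>A\<in>G. \<Sum>a<n. \<Sum>b<n. (cmod (f (A, a, b)))\<^sup>2)"
  have cl: "continuous_on U l" for U
    unfolding l_def pairing_def by (intro continuous_intros continuous_on_product_coordinates
        continuous_on_subset[OF _ subset_UNIV])
  have cQ: "continuous_on U Q" for U
    unfolding Q_def by (intro continuous_intros continuous_on_product_coordinates
        continuous_on_subset[OF _ subset_UNIV])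
  obtain fm where fm: "fm \<in> ?K" "\<And>f. f \<in> ?K \<Longrightarrow> l fm \<le> l f"
    using continuous_attains_inf[OF compact_cp_base[OF S] _ cl] f0 by blast
  define F where "F = {f. l f \<le> l fm} \<inter> ?K"
  have "compact F" unfolding F_def
    by (intro closed_Int_compact compact_cp_base[OF S] closed_Collect_le cl continuous_on_const)
  moreover have "fm \<in> F" using fm by (simp add: F_def)
  ultimately obtain f where f: "f \<in> F" "\<And>g. g \<in> F \<Longrightarrow> Q g \<le> Q f"
    using continuous_attains_sup[OF _ _ cQ, of F] by blast
  have fK: "f \<in> ?K" and lf: "l f = l fm" using f fm(2)[of f] by (auto simp: F_def)
  then have fcp: "cp_form S n f"
    and f_out: "\<And>A a b. \<not> (A \<in> S \<and> a < n \<and> b < n) \<Longrightarrow> f (A, a, b) = 0"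
    and f_tr: "(\<Sum>a<n. f (id_blinfun, a, a)) = 1"
    by (auto simp: cp_base_def)
  have I: "id_blinfun \<in> S" using S by (simp add: operator_system_def)
  have "\<exists>t\<ge>0. \<forall>A\<in>S. \<forall>a<n. \<forall>b<n. f1 (A, a, b) = of_real t * f (A, a, b)"
    if cp: "cp_form S n f1" "cp_form S n f2"
      and sum: "\<forall>A\<in>S. \<forall>a<n. \<forall>b<n. f (A, a, b) = f1 (A, a, b) + f2 (A, a, b)" for f1 f2
  proof -
    have tr_real: "\<exists>t\<ge>0. (\<Sum>a<n. g (id_blinfun, a, a)) = of_real t" if "cp_form S n g" for g
    proof -
      have "0 \<le> (\<Sum>a<n. g (id_blinfun, a, a))"
        by (intro sum_nonneg cp_form_diag_nonneg[OF S that]) auto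
      then show ?thesis
        by (intro exI[of _ "Re (\<Sum>a<n. g (id_blinfun, a, a))"])
          (simp add: less_eq_complex_def complex_eq_iff)
    qed
    obtain t where t: "t \<ge> 0" "(\<Sum>a<n. f1 (id_blinfun, a, a)) = of_real t"
      using tr_real[OF cp(1)] by blast
    obtain u where u: "u \<ge> 0" "(\<Sum>a<n. f2 (id_blinfun, a, a)) = of_real u"
      using tr_real[OF cp(2)] by blast
    have "of_real (t + u) = (1 :: complex)"
      using f_tr sum I by (simp add: sum.distrib flip: t(2) u(2))
    then have tu: "u = 1 - t" by (metis add_diff_cancel_left' of_real_eq_1_iff)
    \<comment> \<open>At either end one summand has trace 0 and therefore vanishes; only in between
      can both be normalised.\<close>
    consider "t = 0" | "u = 0" | "t > 0" "u > 0" using t(1) u(1) by linarith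
    then show ?thesis
    proof cases
      case 1
      then have "f1 (A, a, b) = 0" if "A \<in> S" "a < n" "b < n" for A a b
        using cp_form_trace_bound[OF S cp(1) that] t(2) by simp
      then show ?thesis by (intro exI[of _ 0]) simp
    next
      case 2
      then have "f2 (A, a, b) = 0" if "A \<in> S" "a < n" "b < n" for A a b
        using cp_form_trace_bound[OF S cp(2) that] u(2) by simp
      then show ?thesis using sum by (intro exI[of _ 1]) simp
    next
      case 3
      define g1 where "g1 = normalised_form S n t f1"
      define g2 where "g2 = normalised_form S n u f2"
      have g: "g1 \<in> ?K" "g2 \<in> ?K"
        unfolding g1_def g2_def
        using normalised_form_base[OF S cp(1) 3(1) t(2)] normalised_form_base[OF S cp(2) 3(2) u(2)] .
      have comb: "f x = of_real t * g1 x + of_real (1 - t) * g2 x" for x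
      proof -
        obtain A a b where "x = (A, a, b)" by (metis prod.exhaust)
        moreover have "f (A, a, b) = of_real t * g1 (A, a, b) + of_real u * g2 (A, a, b)"
        proof (cases "A \<in> S \<and> a < n \<and> b < n")
          case True
          then have "g1 (A, a, b) = of_real (1 / t) * f1 (A, a, b)"
            "g2 (A, a, b) = of_real (1 / u) * f2 (A, a, b)"
            by (auto simp: g1_def g2_def normalised_form_def)
          then show ?thesis using True sum 3 by simp
        next
          case False
          then have "g1 (A, a, b) = 0" "g2 (A, a, b) = 0"
            by (auto simp: g1_def g2_def normalised_form_def)
          then show ?thesis using f_out[OF False] by simp
        qed
        ultimately show ?thesis by (simp only: tu)
      qed
      have f_eq: "f = (\<lambda>x. of_real t * g1 x + of_real (1 - t) * g2 x)"
        by (rule ext) (rule comb)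
      have "l f = t * l g1 + (1 - t) * l g2"
        unfolding l_def by (subst f_eq) (rule Re_pairing_combination)
      \<comment> \<open>Both terms are nonnegative by minimality of \<open>fm\<close>, and they add
        up to zero, so \<open>g1\<close> and \<open>g2\<close> are minimisers as well.\<close>
      then have "t * (l g1 - l fm) + u * (l g2 - l fm) = 0"
        using lf unfolding tu by (simp add: algebra_simps)
      moreover have "0 \<le> t * (l g1 - l fm)" "0 \<le> u * (l g2 - l fm)" using 3 fm(2) g by auto
      ultimately have "t * (l g1 - l fm) = 0" "u * (l g2 - l fm) = 0" by linarith+
      then have "g1 \<in> F" "g2 \<in> F" using 3 g by (auto simp: F_def)
      then have Qg: "Q g1 \<le> Q f" "Q g2 \<le> Q f" using f(2) by auto
      \<comment> \<open>Maximality of \<open>Q f\<close> leaves no room for the convexity gap: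
        \<open>g1\<close> and \<open>g2\<close> agree on \<open>G\<close>, and linearity spreads
        this to \<open>S\<close>.\<close>
      have "Q f = t * Q g1 + u * Q g2 - t * u * Q (\<lambda>x. g1 x - g2 x)"
        unfolding Q_def tu by (subst f_eq) (rule sum_cmod_convex_combination)
      moreover have "t * Q g1 + u * Q g2 \<le> t * Q f + u * Q f"
        using Qg 3 by (intro add_mono mult_left_mono) auto
      moreover have "t * Q f + u * Q f = Q f" unfolding tu by (simp add: algebra_simps)
      ultimately have "t * u * Q (\<lambda>x. g1 x - g2 x) \<le> 0" by linarith
      then have "Q (\<lambda>x. g1 x - g2 x) \<le> 0" using 3 by (simp add: mult_le_0_iff zero_less_mult_iff)
      moreover have "0 \<le> Q (\<lambda>x. g1 x - g2 x)" unfolding Q_def by (intro sum_nonneg) simp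
      ultimately have "Q (\<lambda>x. g1 x - g2 x) = 0" by simp
      then have on_G: "\<forall>A\<in>G. \<forall>a<n. \<forall>b<n. g1 (A, a, b) - g2 (A, a, b) = 0"
        unfolding Q_def using G(1) by (simp add: sum_nonneg_eq_0_iff sum_nonneg)
      have "f1 (A, a, b) = of_real t * f (A, a, b)" if "A \<in> S" "a < n" "b < n" for A a b
      proof -
        have "complex_linear_on S (\<lambda>A. g1 (A, a, b) - g2 (A, a, b))"
          using g that
          by (auto simp: cp_base_def cp_form_def linear_form_def complex_linear_on_def algebra_simps)
        then have "g1 (A, a, b) = g2 (A, a, b)" using G(3) on_G that by force
        then have "f (A, a, b) = g1 (A, a, b)" by (simp add: comb algebra_simps)
        then show ?thesis using 3 that by (simp add: g1_def normalised_form_def)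
      qed
      then show ?thesis using t(1) by blast
    qed
  qed
  then have "pure_form S n f" using fcp by (auto simp: pure_form_def)
  then show ?thesis using fK lf fm(2)[OF f0] by (auto simp: l_def)
qed

section \<open>Pure forms and matrix extreme points\<close>

definition sesq :: "nat \<Rightarrow> (nat \<Rightarrow> nat \<Rightarrow> complex) \<Rightarrow> (nat \<Rightarrow> complex) \<Rightarrow> (nat \<Rightarrow> complex) \<Rightarrow> complex" where
  "sesq n p v w = (\<Sum>a<n. \<Sum>b<n. cnj (v a) * p a b * w b)"

lemma sesq_add_left: "sesq n p (\<lambda>a. v a + w a) x = sesq n p v x + sesq n p w x"
  by (simp add: sesq_def sum.distrib distrib_right)

lemma sesq_add_right: "sesq n p x (\<lambda>a. v a + w a) = sesq n p x v + sesq n p x w"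
  by (simp add: sesq_def sum.distrib distrib_left)

lemma sesq_scale_left: "sesq n p (\<lambda>a. c * v a) x = cnj c * sesq n p v x"
  by (simp add: sesq_def sum_distrib_left mult_ac)

lemma sesq_scale_right: "sesq n p x (\<lambda>a. c * v a) = c * sesq n p x v"
  by (simp add: sesq_def sum_distrib_left mult_ac)

lemma sesq_diff_left: "sesq n p (\<lambda>a. v a - w a) x = sesq n p v x - sesq n p w x"
  by (simp add: sesq_def sum_subtractf left_diff_distrib)

lemma sesq_diff_right: "sesq n p x (\<lambda>a. v a - w a) = sesq n p x v - sesq n p x w"
  by (simp add: sesq_def sum_subtractf right_diff_distrib)

lemma sesq_sum_left:
  fixes k :: nat
  shows "sesq n p (\<lambda>a. \<Sum>c<k. z c * v c a) x = (\<Sum>c<k. cnj (z c) * sesq n p (v c) x)"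
  by (induction k) (simp_all add: sesq_add_left sesq_scale_left, simp add: sesq_def)

lemma sesq_sum_right:
  fixes k :: nat
  shows "sesq n p x (\<lambda>a. \<Sum>c<k. z c * v c a) = (\<Sum>c<k. z c * sesq n p x (v c))"
  by (induction k) (simp_all add: sesq_add_right sesq_scale_right, simp add: sesq_def)

lemma sesq_unit:
  assumes "a < n" "b < n"
  shows "sesq n p (\<lambda>i. if i = a then 1 else 0) (\<lambda>i. if i = b then 1 else 0) = p a b"
proof -
  have "cnj (if i = a then 1 else 0) * p i j * (if j = b then 1 else 0)
      = (if j = b then if i = a then p i j else 0 else 0)" for i j
    by simp
  then show ?thesis using assms by (simp add: sesq_def)
qed

lemma sesq_hermitian:
  assumes "\<And>v. 0 \<le> sesq n p v v"
  shows "sesq n p w v = cnj (sesq n p v w)"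
proof -
  have "0 \<le> sesq n p (\<lambda>a. v a + z * w a) (\<lambda>a. v a + z * w a)" for z
    by (rule assms)
  from this[of 1] this[of \<i>] assms[of v] assms[of w] show ?thesis
    by (simp add: sesq_add_left sesq_add_right sesq_scale_left sesq_scale_right
      less_eq_complex_def complex_eq_iff)
qed

text \<open>Padding with zeros to size \<open>k\<close> keeps \<open>L B = 1\<close>, hence
  \<open>B L = 1\<close> for square matrices; but for \<open>n < k\<close> row \<open>n\<close> of
  the padded \<open>B\<close> is zero.\<close>

lemma left_inverse_dim:
  fixes L B :: "nat \<Rightarrow> nat \<Rightarrow> complex"
  assumes inv: "\<And>c d. c < k \<Longrightarrow> d < k \<Longrightarrow> (\<Sum>a<n. L c a * B a d) = (if c = d then 1 else 0)"
  shows "k \<le> n"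
proof (rule ccontr)
  assume "\<not> k \<le> n"
  then have nk: "n < k" by simp
  define L' where "L' = mat k k (\<lambda>(c, a). if a < n then L c a else 0)"
  define B' where "B' = mat k k (\<lambda>(a, d). if a < n then B a d else 0)"
  have carr: "L' \<in> carrier_mat k k" "B' \<in> carrier_mat k k" by (simp_all add: L'_def B'_def)
  have "L' * B' = 1\<^sub>m k"
  proof (rule eq_matI)
    fix c d assume "c < dim_row (1\<^sub>m k)" "d < dim_col (1\<^sub>m k)"
    then have cd: "c < k" "d < k" by simp_all
    have "(L' * B') $$ (c, d) = (\<Sum>a<k. if a < n then L c a * B a d else 0)"
      using cd by (simp add: L'_def B'_def scalar_prod_def lessThan_atLeast0)
        (intro sum.cong refl, simp)
    also have "\<dots> = (\<Sum>a<n. L c a * B a d)"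
      using nk by (intro sum.mono_neutral_cong_right) auto
    finally show "(L' * B') $$ (c, d) = 1\<^sub>m k $$ (c, d)" using inv cd by simp
  qed (simp_all add: L'_def B'_def)
  then have "B' * L' = 1\<^sub>m k" by (rule mat_mult_left_right_inverse[OF carr])
  then have "(B' * L') $$ (n, n) = 1" using nk by simp
  moreover have "(B' * L') $$ (n, n) = 0"
    using nk by (simp add: L'_def B'_def scalar_prod_def)
  ultimately show False by simp
qed

text \<open>The family is a maximal orthonormal one for the semi-inner product \<open>p\<close>: a
  residual of nonzero length, once normalised, would extend it. Residuals are null vectors but need
  not be 0, as \<open>p\<close> may be degenerate.\<close>

lemma exists_frame:
  assumes pos: "\<And>v. 0 \<le> sesq n p v v"
  obtains k :: nat and \<delta> where
    "\<forall>c<k. \<forall>d<k. sesq n p (\<delta> c) (\<delta> d) = (if c = d then 1 else 0)"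
    "\<forall>w w'. w' = (\<lambda>a. w a - (\<Sum>c<k. sesq n p (\<delta> c) w * \<delta> c a)) \<longrightarrow> sesq n p w' w' = 0"
proof -
  define P where "P = (\<lambda>k::nat. \<exists>\<delta>. \<forall>c<k. \<forall>d<k. sesq n p (\<delta> c) (\<delta> d) = (if c = d then 1 else 0))"
  \<comment> \<open>Orthonormality says that the matrix \<open>\<delta>* p\<close> is a left inverse
    of the one with columns \<open>\<delta> d\<close>.\<close>
  have bound: "k \<le> n" if "P k" for k
  proof -
    obtain \<delta> where \<delta>: "\<And>c d. c < k \<Longrightarrow> d < k \<Longrightarrow> sesq n p (\<delta> c) (\<delta> d) = (if c = d then 1 else 0)"
      using \<open>P k\<close> unfolding P_def by blast
    have "(\<Sum>b<n. (\<Sum>a<n. cnj (\<delta> c a) * p a b) * \<delta> d b) = sesq n p (\<delta> c) (\<delta> d)" for c d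
      unfolding sesq_def by (subst sum.swap) (simp add: sum_distrib_right)
    with \<delta> show ?thesis
      by (intro left_inverse_dim[where L = "\<lambda>c b. \<Sum>a<n. cnj (\<delta> c a) * p a b" and B = "\<lambda>b d. \<delta> d b"])
        simp
  qed
  have "P 0" by (simp add: P_def)
  then obtain k where k: "P k" "\<And>j. P j \<Longrightarrow> j \<le> k"
    using bound ex_has_greatest_nat[of P 0 "\<lambda>x. x" "Suc n"] by (auto simp: less_Suc_eq_le)
  obtain \<delta> where \<delta>: "\<forall>c<k. \<forall>d<k. sesq n p (\<delta> c) (\<delta> d) = (if c = d then 1 else 0)"
    using k(1) unfolding P_def by blast
  have "sesq n p w' w' = 0" if w': "w' = (\<lambda>a. w a - (\<Sum>c<k. sesq n p (\<delta> c) w * \<delta> c a))" for w w'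
  proof (rule ccontr)
    assume nz: "sesq n p w' w' \<noteq> 0"
    define r where "r = Re (sesq n p w' w')"
    have r: "sesq n p w' w' = of_real r" "r > 0"
      using nz pos[of w'] by (auto simp: r_def less_eq_complex_def complex_eq_iff)
    have orth: "sesq n p (\<delta> d) w' = 0" if "d < k" for d
    proof -
      have "sesq n p (\<delta> d) w' = sesq n p (\<delta> d) w - (\<Sum>c<k. sesq n p (\<delta> c) w * sesq n p (\<delta> d) (\<delta> c))"
        by (simp add: w' sesq_diff_right sesq_sum_right)
      also have "(\<Sum>c<k. sesq n p (\<delta> c) w * sesq n p (\<delta> d) (\<delta> c))
          = (\<Sum>c<k. if c = d then sesq n p (\<delta> c) w else 0)"
        using \<delta> that by (intro sum.cong) auto
      finally show ?thesis using that by simp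
    qed
    have orth': "sesq n p w' (\<delta> d) = 0" if "d < k" for d
      using sesq_hermitian[OF pos, where v = "\<delta> d" and w = w'] orth[OF that] by simp
    define z where "z = complex_of_real (1 / sqrt r)"
    have "1 / sqrt r * (1 / sqrt r * r) = 1" using r(2) by simp
    then have z: "cnj z * (z * of_real r) = 1"
      by (metis z_def complex_cnj_complex_of_real of_real_1 of_real_mult)
    define \<eta> where "\<eta> = \<delta>(k := (\<lambda>a. z * w' a))"
    have "sesq n p (\<eta> c) (\<eta> d) = (if c = d then 1 else 0)" if "c < Suc k" "d < Suc k" for c d
      using that \<delta> orth orth' r(1) z
      by (auto simp: \<eta>_def sesq_scale_left sesq_scale_right less_Suc_eq mult.assoc)
    then have "P (Suc k)" unfolding P_def by blast
    then show False using k(2) by fastforce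
  qed
  with \<delta> show thesis by (intro that) auto
qed

section \<open>Factoring a form through a unital one\<close>

lemma form_compress_compress:
  "form_compress n G (form_compress k H f) = form_compress k (\<lambda>c a. \<Sum>b<n. H c b * G b a) f"
proof (rule ext)
  fix x :: "'a \<times> nat \<times> nat"
  obtain A i j where x: "x = (A, i, j)" by (metis prod.exhaust)
  have "form_compress n G (form_compress k H f) x
      = (\<Sum>a<n. \<Sum>b<n. \<Sum>c<k. \<Sum>d<k. cnj (G a i) * (cnj (H c a) * f (A, c, d) * H d b) * G b j)"
    by (simp add: form_compress_def x sum_distrib_left sum_distrib_right)
  also have "\<dots> = (\<Sum>c<k. \<Sum>d<k. \<Sum>a<n. \<Sum>b<n.
      cnj (G a i) * (cnj (H c a) * f (A, c, d) * H d b) * G b j)"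
    by (rule sum_swap4)
  also have "\<dots> = (\<Sum>c<k. \<Sum>d<k. cnj (\<Sum>b<n. H c b * G b i) * f (A, c, d) * (\<Sum>b<n. H d b * G b j))"
  proof (intro sum.cong refl)
    fix c d
    have "(\<Sum>a<n. \<Sum>b<n. cnj (G a i) * (cnj (H c a) * f (A, c, d) * H d b) * G b j)
        = (\<Sum>a<n. \<Sum>b<n. f (A, c, d) * (cnj (H c a * G a i) * (H d b * G b j)))"
      by (intro sum.cong refl) (simp add: mult_ac)
    also have "\<dots> = f (A, c, d) * ((\<Sum>a<n. cnj (H c a * G a i)) * (\<Sum>b<n. H d b * G b j))"
      unfolding sum_product by (simp only: sum_distrib_left)
    finally show "(\<Sum>a<n. \<Sum>b<n. cnj (G a i) * (cnj (H c a) * f (A, c, d) * H d b) * G b j)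
        = cnj (\<Sum>b<n. H c b * G b i) * f (A, c, d) * (\<Sum>b<n. H d b * G b j)"
      by (simp only: cnj_sum mult_ac)
  qed
  finally show "form_compress n G (form_compress k H f) x
      = form_compress k (\<lambda>c a. \<Sum>b<n. H c b * G b a) f x"
    by (simp add: form_compress_def x)
qed

lemma form_compress_identity:
  assumes "\<And>c d. c < k \<Longrightarrow> d < k \<Longrightarrow> G c d = (if c = d then 1 else 0)" and "i < k" "j < k"
  shows "form_compress k G f (A, i, j) = f (A, i, j)"
proof -
  have "form_compress k G f (A, i, j)
      = (\<Sum>a<k. \<Sum>b<k. if b = j then if a = i then f (A, a, b) else 0 else 0)"
    unfolding form_compress_def prod.case using assms by (intro sum.cong refl) auto
  then show ?thesis using assms(2,3) by simp
qed

lemma cp_form_add: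
  assumes "cp_form S n f" "cp_form S n g"
  shows "cp_form S n (\<lambda>x. f x + g x)"
  using assms
  by (simp add: cp_form_def linear_form_def complex_linear_on_def pairing_def sum.distrib
    distrib_left add_nonneg_nonneg ac_simps)

lemma cp_form_sum:
  assumes "\<And>i. i \<in> I \<Longrightarrow> cp_form S n (f i)"
  shows "cp_form S n (\<lambda>x. \<Sum>i\<in>I. f i x)"
  using assms
proof (induction I rule: infinite_finite_induct)
  case (insert i I)
  then show ?case using cp_form_add[of S n "f i" "\<lambda>x. \<Sum>i\<in>I. f i x"] by simp
qed (simp_all add: cp_form_def linear_form_def complex_linear_on_def pairing_def)

text \<open>
  A form is carried by the quotient by the null space of its value at the unit, so that it is a
  compression of a unital form.
\<close>

lemma cp_form_factor:
  assumes S: "operator_system S" and f: "cp_form S n f"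
  obtains k :: nat and \<gamma> \<delta> where
    "\<And>c d. c < k \<Longrightarrow> d < k \<Longrightarrow> (\<Sum>a<n. \<gamma> c a * \<delta> a d) = (if c = d then 1 else 0)"
    "\<And>c d. c < k \<Longrightarrow> d < k \<Longrightarrow>
       form_compress n \<delta> f (id_blinfun, c, d) = (if c = d then 1 else 0)"
    "\<And>A a b. A \<in> S \<Longrightarrow> a < n \<Longrightarrow> b < n \<Longrightarrow>
       f (A, a, b) = form_compress k \<gamma> (form_compress n \<delta> f) (A, a, b)"
proof -
  define p where "p = (\<lambda>a b. f (id_blinfun, a, b))"
  have pos: "0 \<le> sesq n p v v" for v
    using cp_form_unit_nonneg[OF S f, of v] by (simp add: sesq_def p_def)
  obtain k :: nat and \<delta> where orth: "\<forall>c<k. \<forall>d<k. sesq n p (\<delta> c) (\<delta> d) = (if c = d then 1 else 0)"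
    and null: "\<forall>w w'. w' = (\<lambda>a. w a - (\<Sum>c<k. sesq n p (\<delta> c) w * \<delta> c a))
      \<longrightarrow> sesq n p w' w' = 0"
    using exists_frame[OF pos] by blast
  define e where "e = (\<lambda>a i :: nat. if i = a then 1 else 0 :: complex)"
  \<comment> \<open>Coordinates of the standard basis vectors in the frame. Thus
    \<open>\<gamma> \<Delta> = 1\<close>, whereas \<open>\<Delta> \<gamma>\<close> is the identity
    only modulo null vectors.\<close>
  define \<gamma> where "\<gamma> = (\<lambda>c a. sesq n p (\<delta> c) (e a))"
  define \<Delta> where "\<Delta> = (\<lambda>a c. \<delta> c a)"
  have comp: "form_compress n \<Delta> f (A, c, d) = sesq n (\<lambda>a b. f (A, a, b)) (\<delta> c) (\<delta> d)" for A c d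
    by (simp add: form_compress_def sesq_def \<Delta>_def)
  have "(\<Sum>a<n. \<gamma> c a * \<Delta> a d) = sesq n p (\<delta> c) (\<delta> d)" for c d
  proof -
    have "sesq n p (\<delta> c) (\<delta> d) = sesq n p (\<delta> c) (\<lambda>i. \<Sum>a<n. \<delta> d a * e a i)"
      unfolding sesq_def by (intro sum.cong refl) (simp add: e_def if_distrib cong: if_cong)
    then show ?thesis by (simp add: sesq_sum_right \<gamma>_def \<Delta>_def mult.commute)
  qed
  moreover have "f (A, a, b) = form_compress k \<gamma> (form_compress n \<Delta> f) (A, a, b)"
    if A: "A \<in> S" and ab: "a < n" "b < n" for A a b
  proof -
    let ?F = "sesq n (\<lambda>a b. f (A, a, b))"
    define R where "R = (\<lambda>a i. \<Sum>c<k. \<gamma> c a * \<delta> c i)"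
    have n0: "sesq n p (\<lambda>i. e a i - R a i) (\<lambda>i. e a i - R a i) = 0" for a
      by (rule null[rule_format, of _ "e a"]) (simp add: R_def \<gamma>_def)
    have null_r: "?F v (\<lambda>i. e b i - R b i) = 0" and null_l: "?F (\<lambda>i. e b i - R b i) v = 0" for b v
      using cp_form_unit_null[OF S f A, of "\<lambda>i. e b i - R b i" v] n0[of b]
      by (simp_all add: sesq_def p_def)
    \<comment> \<open>Each \<open>e a - R a\<close> is null at the unit, hence null for every
      \<open>A\<close>, so both basis vectors may be replaced by their projections.\<close>
    have "f (A, a, b) = ?F (e a) (e b)" using ab by (simp add: e_def sesq_unit)
    also have "\<dots> = ?F (e a) (R b)" using null_r[of "e a" b] by (simp add: sesq_diff_right)
    also have "\<dots> = ?F (R a) (R b)" using null_l[of a "R b"] by (simp add: sesq_diff_left)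
    also have "\<dots> = (\<Sum>c<k. \<Sum>d<k. cnj (\<gamma> c a) * ?F (\<delta> c) (\<delta> d) * \<gamma> d b)"
      unfolding R_def sesq_sum_left sesq_sum_right by (simp add: sum_distrib_left mult_ac)
    finally show ?thesis by (simp add: form_compress_def[of k] comp)
  qed
  moreover have "form_compress n \<Delta> f (id_blinfun, c, d) = sesq n p (\<delta> c) (\<delta> d)" for c d
    by (simp add: comp p_def)
  ultimately show thesis using orth by (intro that[of k \<gamma> \<Delta>]) simp_all
qed

section \<open>Dictionary between forms and unital completely positive maps\<close>

lemma mat_adjoint_carrier: "A \<in> carrier_mat m n \<Longrightarrow> mat_adjoint A \<in> carrier_mat n m"
  unfolding mat_adjoint_def by auto

lemma mat_adjoint_index:
  fixes A :: "complex mat"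
  assumes "A \<in> carrier_mat m n" "i < n" "j < m"
  shows "mat_adjoint A $$ (i, j) = cnj (A $$ (j, i))"
  using assms unfolding mat_adjoint_def by (simp add: mat_of_rows_index)

lemma adjoint_mult_index:
  fixes \<gamma> :: "complex mat"
  assumes "\<gamma> \<in> carrier_mat m n" "a < n" "b < n"
  shows "(mat_adjoint \<gamma> * \<gamma>) $$ (a, b) = (\<Sum>c<m. cnj (\<gamma> $$ (c, a)) * \<gamma> $$ (c, b))"
  using assms mat_adjoint_carrier[OF assms(1)]
  by (simp add: scalar_prod_def lessThan_atLeast0 mat_adjoint_index)

lemma adjoint_mult_mult_index:
  fixes \<gamma> M :: "complex mat"
  assumes "\<gamma> \<in> carrier_mat m n" "M \<in> carrier_mat m m" "a < n" "b < n"
  shows "(mat_adjoint \<gamma> * M * \<gamma>) $$ (a, b)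
    = (\<Sum>c<m. \<Sum>d<m. cnj (\<gamma> $$ (c, a)) * M $$ (c, d) * \<gamma> $$ (d, b))"
proof -
  have "(mat_adjoint \<gamma> * M * \<gamma>) $$ (a, b)
      = (\<Sum>c<m. cnj (\<gamma> $$ (c, a)) * (\<Sum>d<m. M $$ (c, d) * \<gamma> $$ (d, b)))"
    using assms mat_adjoint_carrier[OF assms(1)]
    by (simp add: scalar_prod_def lessThan_atLeast0 mat_adjoint_index)
  then show ?thesis by (simp add: sum_distrib_left mult.assoc)
qed

lemma UCP_carrier: "\<Phi> \<in> UCP S m \<Longrightarrow> A \<in> S \<Longrightarrow> \<Phi> A \<in> carrier_mat m m"
  by (simp add: UCP_def)

text \<open>Positivity of the block matrix at level \<open>m\<close>, tested on the tuple of
  standard basis vectors, is nonnegativity of the pairing.\<close>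

lemma cp_form_UCP:
  fixes S :: "('a::complex_hilbert \<Rightarrow>\<^sub>L 'a) set"
  assumes \<Phi>: "\<Phi> \<in> UCP S m" and m: "0 < m"
  shows "cp_form S m (\<lambda>(A, a, b). \<Phi> A $$ (a, b))"
proof -
  note carr = UCP_carrier[OF \<Phi>]
  have add: "\<Phi> (A + B) = \<Phi> A + \<Phi> B" if "A \<in> S" "B \<in> S" for A B
    using \<Phi> that by (simp add: UCP_def)
  have scale: "\<Phi> (c *\<^sub>C A) = c \<cdot>\<^sub>m \<Phi> A" if "A \<in> S" for c A
    using \<Phi> that by (simp add: UCP_def)
  have "linear_form S m (\<lambda>(A, a, b). \<Phi> A $$ (a, b))"
    unfolding linear_form_def complex_linear_on_def prod.case
  proof (intro allI impI conjI ballI)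
    fix a b A B assume *: "a < m" "b < m" "A \<in> S" "B \<in> S"
    then show "\<Phi> (A + B) $$ (a, b) = \<Phi> A $$ (a, b) + \<Phi> B $$ (a, b)"
      using carr[OF *(3)] carr[OF *(4)] by (simp add: add)
  next
    fix a b c A assume *: "a < m" "b < m" "A \<in> S"
    then show "\<Phi> (c *\<^sub>C A) $$ (a, b) = c * \<Phi> A $$ (a, b)"
      using carr[OF *(3)] by (simp add: scale)
  qed
  moreover have "0 \<le> pairing m (\<lambda>(A, a, b). \<Phi> A $$ (a, b)) X"
    if X: "\<forall>a<m. \<forall>b<m. X a b \<in> S" "positive_op_matrix m X" for X
  proof -
    have "positive_block_matrix m m (\<lambda>i j. \<Phi> (X i j))"
      using \<Phi> X m by (simp add: UCP_def Suc_leI)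
    then have "0 \<le> (\<Sum>i<m. \<Sum>j<m. (\<Phi> (X i j) *\<^sub>v unit_vec m j) \<bullet>c unit_vec m i)"
      by (auto simp: positive_block_matrix_def)
    also have "\<dots> = (\<Sum>i<m. \<Sum>j<m. \<Phi> (X i j) $$ (i, j))"
    proof (intro sum.cong refl)
      fix i j assume "i \<in> {..<m}" "j \<in> {..<m}"
      then have ij: "i < m" "j < m" by auto
      have M: "\<Phi> (X i j) \<in> carrier_mat m m" using X ij carr by blast
      have "conjugate (unit_vec m i) = (unit_vec m i :: complex vec)"
        by (rule eq_vecI) (auto simp: unit_vec_def)
      then show "(\<Phi> (X i j) *\<^sub>v unit_vec m j) \<bullet>c unit_vec m i = \<Phi> (X i j) $$ (i, j)"
        using ij M by (simp add: scalar_prod_right_unit)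
    qed
    finally show ?thesis by (simp add: pairing_def)
  qed
  ultimately show ?thesis by (simp add: cp_form_def)
qed

text \<open>The quadratic form of a block matrix at \<open>h\<close> is a pairing with
  \<open>f\<close> compressed by the matrix with columns \<open>h i\<close>, so
  \<open>cp_form_amplified\<close> gives positivity at all levels.\<close>

lemma UCP_form:
  assumes S: "operator_system S" and f: "cp_form S k f"
    and unit: "\<And>c d. c < k \<Longrightarrow> d < k \<Longrightarrow> f (id_blinfun, c, d) = (if c = d then 1 else 0)"
  shows "(\<lambda>A. mat k k (\<lambda>(c, d). f (A, c, d))) \<in> UCP S k"
proof -
  let ?\<Phi> = "\<lambda>A. mat k k (\<lambda>(c, d). f (A, c, d))"
  have add: "f (A + B, a, b) = f (A, a, b) + f (B, a, b)"
    and scale: "f (c *\<^sub>C A, a, b) = c * f (A, a, b)"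
    if "a < k" "b < k" "A \<in> S" "B \<in> S" for A B a b c
    using f that by (auto simp: cp_form_def linear_form_def complex_linear_on_def)
  have pos: "positive_block_matrix k q (\<lambda>i j. ?\<Phi> (X i j))"
    if X: "\<forall>i<q. \<forall>j<q. X i j \<in> S" "positive_op_matrix q X" for q X
    unfolding positive_block_matrix_def
  proof (intro allI impI)
    fix h :: "nat \<Rightarrow> complex vec"
    assume h: "\<forall>i<q. h i \<in> carrier_vec k"
    have "(\<Sum>i<q. \<Sum>j<q. (?\<Phi> (X i j) *\<^sub>v h j) \<bullet>c h i)
        = pairing q (form_compress k (\<lambda>a i. h i $ a) f) X"
      unfolding pairing_def form_compress_def prod.case
    proof (intro sum.cong refl)
      fix i j assume "i \<in> {..<q}" "j \<in> {..<q}"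
      then have h: "h i \<in> carrier_vec k" "h j \<in> carrier_vec k" using h by auto
      then have "(?\<Phi> (X i j) *\<^sub>v h j) \<bullet>c h i
          = (\<Sum>a<k. (\<Sum>b<k. f (X i j, a, b) * h j $ b) * cnj (h i $ a))"
        by (simp add: scalar_prod_def lessThan_atLeast0)
      then show "(?\<Phi> (X i j) *\<^sub>v h j) \<bullet>c h i
          = (\<Sum>a<k. \<Sum>b<k. cnj (h i $ a) * f (X i j, a, b) * h j $ b)"
        by (simp add: sum_distrib_right sum_distrib_left mult_ac)
    qed
    then show "0 \<le> (\<Sum>i<q. \<Sum>j<q. (?\<Phi> (X i j) *\<^sub>v h j) \<bullet>c h i)"
      using cp_form_amplified[OF S f X] by simp
  qed
  have "?\<Phi> (A + B) = ?\<Phi> A + ?\<Phi> B" if "A \<in> S" "B \<in> S" for A B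
    by (rule eq_matI) (use that in \<open>auto simp: add\<close>)
  moreover have "?\<Phi> (c *\<^sub>C A) = c \<cdot>\<^sub>m ?\<Phi> A" if "A \<in> S" for A c
    by (rule eq_matI) (use that in \<open>auto simp: scale\<close>)
  moreover have "?\<Phi> id_blinfun = 1\<^sub>m k"
    by (rule eq_matI) (auto simp: unit)
  ultimately show ?thesis using pos by (simp add: UCP_def)
qed

lemma surjective_mat_right_inverse:
  assumes "surjective_mat m n \<gamma>"
  obtains R where "\<And>c d. c < m \<Longrightarrow> d < m \<Longrightarrow>
    (\<Sum>a<n. \<gamma> $$ (c, a) * R a d) = (if c = d then 1 else 0)"
proof -
  have carr: "\<gamma> \<in> carrier_mat m n" and surj: "(*\<^sub>v) \<gamma> ` carrier_vec n = carrier_vec m"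
    using assms by (auto simp: surjective_mat_def)
  have "\<exists>v\<in>carrier_vec n. \<gamma> *\<^sub>v v = unit_vec m d" for d
    using surj unit_vec_carrier[of m d] by (metis imageE)
  then obtain v where v: "\<And>d. v d \<in> carrier_vec n" "\<And>d. \<gamma> *\<^sub>v v d = unit_vec m d" by metis
  show thesis
  proof (rule that)
    fix c d assume cd: "c < m" "d < m"
    have "(\<Sum>a<n. \<gamma> $$ (c, a) * v d $ a) = (\<gamma> *\<^sub>v v d) $ c"
      using carr v(1)[of d] cd by (simp add: scalar_prod_def lessThan_atLeast0)
    then show "(\<Sum>a<n. \<gamma> $$ (c, a) * v d $ a) = (if c = d then 1 else 0)"
      using cd by (simp add: v(2))
  qed
qed

text \<open>Surjectivity gives a right inverse, hence \<open>m \<le> k\<close>; the isometry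
  relation gives a left inverse, hence \<open>k \<le> m\<close>. What remains is the normalising
  factor \<open>1 / sqrt t\<close>.\<close>

lemma proportional_isometry_unitary:
  assumes \<gamma>: "surjective_mat m k \<gamma>" and m: "0 < m" and k: "0 < k" and t: "0 \<le> t"
    and iso: "\<And>c d. c < k \<Longrightarrow> d < k \<Longrightarrow>
      (\<Sum>e<m. cnj (\<gamma> $$ (e, c)) * \<gamma> $$ (e, d)) = (if c = d then of_real t else 0)"
  shows "m = k" and "0 < t" and "unitary_mat k (of_real (1 / sqrt t) \<cdot>\<^sub>m \<gamma>)"
proof -
  have carr: "\<gamma> \<in> carrier_mat m k" using \<gamma> by (simp add: surjective_mat_def)
  obtain R where R: "\<And>c d. c < m \<Longrightarrow> d < m \<Longrightarrow>
    (\<Sum>a<k. \<gamma> $$ (c, a) * R a d) = (if c = d then 1 else 0)"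
    by (rule surjective_mat_right_inverse[OF \<gamma>]) blast
  have mk: "m \<le> k" by (rule left_inverse_dim[OF R])
  \<comment> \<open>For \<open>t = 0\<close> all columns of \<open>\<gamma>\<close> would have norm
    0, contradicting surjectivity onto a space of positive dimension.\<close>
  show t0: "0 < t"
  proof (rule ccontr)
    assume "\<not> 0 < t"
    then have "t = 0" using t by simp
    have "\<gamma> $$ (0, a) = 0" if "a < k" for a
    proof -
      have "complex_of_real (\<Sum>e<m. (cmod (\<gamma> $$ (e, a)))\<^sup>2)
          = (\<Sum>e<m. cnj (\<gamma> $$ (e, a)) * \<gamma> $$ (e, a))"
        by (simp only: of_real_sum complex_norm_square mult.commute)
      also have "\<dots> = 0" using iso[OF that that] \<open>t = 0\<close> by simp
      finally have "(\<Sum>e<m. (cmod (\<gamma> $$ (e, a)))\<^sup>2) = 0" by (simp only: of_real_eq_0_iff)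
      then show ?thesis using m by (simp add: sum_nonneg_eq_0_iff)
    qed
    then show False using R[OF m m] by simp
  qed
  have "k \<le> m"
  proof (rule left_inverse_dim)
    fix c d assume "c < k" "d < k"
    then have "(\<Sum>e<m. cnj (\<gamma> $$ (e, c)) * \<gamma> $$ (e, d)) = (if c = d then of_real t else 0)"
      by (rule iso)
    then show "(\<Sum>e<m. (cnj (\<gamma> $$ (e, c)) / of_real t) * \<gamma> $$ (e, d)) = (if c = d then 1 else 0)"
      using t0 by (simp flip: sum_divide_distrib)
  qed
  with mk show mk': "m = k" by simp
  let ?u = "of_real (1 / sqrt t) \<cdot>\<^sub>m \<gamma>"
  have u: "?u \<in> carrier_mat k k" using carr mk' by simp
  have "mat_adjoint ?u * ?u = 1\<^sub>m k"
  proof (rule eq_matI)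
    fix c d assume "c < dim_row (1\<^sub>m k)" "d < dim_col (1\<^sub>m k)"
    then have cd: "c < k" "d < k" by simp_all
    have "1 / sqrt t * (1 / sqrt t) = 1 / t" using t0 by simp
    then have sq: "complex_of_real (1 / sqrt t) * of_real (1 / sqrt t) = of_real (1 / t)"
      by (metis of_real_mult)
    have "(mat_adjoint ?u * ?u) $$ (c, d)
        = (\<Sum>e<k. cnj (of_real (1 / sqrt t) * \<gamma> $$ (e, c)) * (of_real (1 / sqrt t) * \<gamma> $$ (e, d)))"
      using adjoint_mult_index[OF u cd] carr mk' cd by simp
    also have "\<dots> = (\<Sum>e<k. of_real (1 / t) * (cnj (\<gamma> $$ (e, c)) * \<gamma> $$ (e, d)))"
      unfolding sq[symmetric] by (intro sum.cong refl) (simp only: complex_cnj_mult complex_cnj_complex_of_real mult_ac)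
    also have "\<dots> = of_real (1 / t) * (\<Sum>e<k. cnj (\<gamma> $$ (e, c)) * \<gamma> $$ (e, d))"
      by (rule sum_distrib_left[symmetric])
    also have "\<dots> = (1\<^sub>m k) $$ (c, d)" using iso[OF cd] mk' t0 cd by simp
    finally show "(mat_adjoint ?u * ?u) $$ (c, d) = (1\<^sub>m k) $$ (c, d)" .
  qed (use u mat_adjoint_carrier[OF u] in auto)
  then show "unitary_mat k ?u"
    unfolding unitary_mat_def
    using u mat_mult_left_right_inverse[OF mat_adjoint_carrier[OF u] u] by blast
qed

lemma pure_formD:
  assumes "pure_form S n f" "cp_form S n f1" "cp_form S n f2"
    and "\<And>A a b. A \<in> S \<Longrightarrow> a < n \<Longrightarrow> b < n \<Longrightarrow> f (A, a, b) = f1 (A, a, b) + f2 (A, a, b)"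
  shows "\<exists>t\<ge>0. \<forall>A\<in>S. \<forall>a<n. \<forall>b<n. f1 (A, a, b) = of_real t * f (A, a, b)"
  by (rule assms(1)[unfolded pure_form_def, THEN conjunct2, THEN spec[of _ f1], THEN spec[of _ f2],
        THEN mp])
    (use assms(2-4) in simp)

text \<open>Purity concerns \<open>f\<close> at level \<open>n\<close>, extremality concerns
  \<open>\<psi>\<close> at level \<open>k\<close>. A decomposition of \<open>\<psi>\<close> is
  compressed by \<open>\<gamma>\<close> to one of \<open>f\<close>, where purity gives
  proportionality, and the right inverse \<open>\<delta>\<close> of \<open>\<gamma>\<close> carries
  this back. At the unit it reads \<open>\<Gamma>* \<Gamma> = t 1\<close> for each
  coefficient.\<close>

lemma pure_form_matrix_extreme:
  fixes S :: "('a::complex_hilbert \<Rightarrow>\<^sub>L 'a) set"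
  assumes S: "operator_system S" and base: "f \<in> cp_base S n" and pure: "pure_form S n f"
  obtains k \<gamma> \<psi> where "cp_form S k \<psi>"
    "matrix_extreme S k (\<lambda>A. mat k k (\<lambda>(c, d). \<psi> (A, c, d)))"
    "\<forall>A\<in>S. \<forall>a<n. \<forall>b<n. f (A, a, b) = form_compress k \<gamma> \<psi> (A, a, b)"
proof -
  have f: "cp_form S n f" and tr: "(\<Sum>a<n. f (id_blinfun, a, a)) = 1"
    using base by (auto simp: cp_base_def)
  have I: "id_blinfun \<in> S" using S by (simp add: operator_system_def)
  obtain k :: nat and \<gamma> \<delta> where
    inv: "\<And>c d. c < k \<Longrightarrow> d < k \<Longrightarrow> (\<Sum>a<n. \<gamma> c a * \<delta> a d) = (if c = d then 1 else 0)"
    and unit: "\<And>c d. c < k \<Longrightarrow> d < k \<Longrightarrow>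
       form_compress n \<delta> f (id_blinfun, c, d) = (if c = d then 1 else 0)"
    and factor: "\<And>A a b. A \<in> S \<Longrightarrow> a < n \<Longrightarrow> b < n \<Longrightarrow>
       f (A, a, b) = form_compress k \<gamma> (form_compress n \<delta> f) (A, a, b)"
    using cp_form_factor[OF S f] by blast
  define \<psi> where "\<psi> = form_compress n \<delta> f"
  have \<psi>: "cp_form S k \<psi>" unfolding \<psi>_def by (rule cp_form_compress[OF S f])
  \<comment> \<open>Level 0 would make \<open>f\<close> vanish at the unit, against its trace
    1.\<close>
  have "k \<noteq> 0"
  proof
    assume "k = 0"
    then have "(\<Sum>a<n. f (id_blinfun, a, a)) = 0"
      using factor[OF I] by (simp add: form_compress_def)
    then show False using tr by simp
  qed
  then have k: "0 < k" by simp
  have cancel: "form_compress n \<delta> (form_compress k \<gamma> g) (A, c, d) = g (A, c, d)"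
    if "c < k" "d < k" for g :: "('a \<Rightarrow>\<^sub>L 'a) \<times> nat \<times> nat \<Rightarrow> complex" and A c d
    unfolding form_compress_compress using inv that by (intro form_compress_identity) auto
  define \<Phi> where "\<Phi> = (\<lambda>A. mat k k (\<lambda>(c, d). \<psi> (A, c, d)))"
  have "\<Phi> \<in> UCP S k" unfolding \<Phi>_def using unit by (intro UCP_form[OF S \<psi>]) (simp add: \<psi>_def)
  moreover have "m i = k \<and> (\<exists>u. unitary_mat k u \<and> (\<forall>A\<in>S. \<Phi> A = mat_adjoint u * \<Psi> i A * u))"
    if comb: "\<forall>i<q. 0 < m i \<and> \<Psi> i \<in> UCP S (m i) \<and> surjective_mat (m i) k (\<Gamma> i)"
      and sum: "\<forall>A\<in>S. \<Phi> A = mat_sum k q (\<lambda>i. mat_adjoint (\<Gamma> i) * \<Psi> i A * \<Gamma> i)"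
      and i: "i < q" for q m \<Psi> \<Gamma> i
  proof -
    define g where "g = (\<lambda>j. form_compress (m j) (\<lambda>e c. \<Gamma> j $$ (e, c)) (\<lambda>(A, a, b). \<Psi> j A $$ (a, b)))"
    have carr: "\<Gamma> j \<in> carrier_mat (m j) k" if "j < q" for j
      using comb that by (simp add: surjective_mat_def)
    have carr': "\<Psi> j A \<in> carrier_mat (m j) (m j)" if "j < q" "A \<in> S" for j A
      using comb that UCP_carrier by blast
    have g_cp: "cp_form S k (g j)" if "j < q" for j
      unfolding g_def using comb that by (intro cp_form_compress[OF S] cp_form_UCP) auto
    have g_index: "(mat_adjoint (\<Gamma> j) * \<Psi> j A * \<Gamma> j) $$ (c, d) = g j (A, c, d)"
      if "j < q" "A \<in> S" "c < k" "d < k" for j A c d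
      unfolding g_def form_compress_def prod.case
      by (rule adjoint_mult_mult_index[OF carr[OF that(1)] carr'[OF that(1,2)] that(3,4)])
    have \<psi>_sum: "\<psi> (A, c, d) = g i (A, c, d) + (\<Sum>j\<in>{..<q}-{i}. g j (A, c, d))"
      if A: "A \<in> S" and cd: "c < k" "d < k" for A c d
    proof -
      have "\<psi> (A, c, d) = \<Phi> A $$ (c, d)" using cd by (simp add: \<Phi>_def)
      also have "\<dots> = (\<Sum>j<q. g j (A, c, d))"
        using sum A cd by (simp add: mat_sum_def g_index)
      finally show ?thesis using i by (simp add: sum.remove)
    qed
    \<comment> \<open>The chosen summand against all others taken together, since purity speaks of
      two summands.\<close>
    define f1 where "f1 = form_compress k \<gamma> (g i)"
    define f2 where "f2 = form_compress k \<gamma> (\<lambda>x. \<Sum>j\<in>{..<q}-{i}. g j x)"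
    have "cp_form S n f1" unfolding f1_def by (rule cp_form_compress[OF S g_cp[OF i]])
    moreover have "cp_form S n f2"
      unfolding f2_def by (intro cp_form_compress[OF S] cp_form_sum g_cp) auto
    moreover have "f (A, a, b) = f1 (A, a, b) + f2 (A, a, b)" if "A \<in> S" "a < n" "b < n" for A a b
    proof -
      have "f (A, a, b) = (\<Sum>c<k. \<Sum>d<k. cnj (\<gamma> c a) * \<psi> (A, c, d) * \<gamma> d b)"
        using factor[OF that] by (simp add: \<psi>_def form_compress_def[of k])
      also have "\<dots> = (\<Sum>c<k. \<Sum>d<k. cnj (\<gamma> c a) * g i (A, c, d) * \<gamma> d b
          + cnj (\<gamma> c a) * (\<Sum>j\<in>{..<q}-{i}. g j (A, c, d)) * \<gamma> d b)"
        using \<psi>_sum[OF that(1)] by (intro sum.cong refl) (simp add: distrib_left distrib_right)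
      finally show ?thesis by (simp add: f1_def f2_def form_compress_def sum.distrib)
    qed
    ultimately obtain t :: real where t: "0 \<le> t"
      "\<forall>A\<in>S. \<forall>a<n. \<forall>b<n. f1 (A, a, b) = of_real t * f (A, a, b)"
      using pure_formD[OF pure, of f1 f2] by auto
    have g_eq: "g i (A, c, d) = of_real t * \<psi> (A, c, d)" if "A \<in> S" "c < k" "d < k" for A c d
    proof -
      have "g i (A, c, d) = form_compress n \<delta> f1 (A, c, d)"
        unfolding f1_def by (rule cancel[OF that(2,3), symmetric])
      also have "\<dots> = of_real t * \<psi> (A, c, d)"
        using t(2) that(1) by (simp add: \<psi>_def form_compress_def sum_distrib_left mult_ac)
      finally show ?thesis .
    qed
    have iso: "(\<Sum>e<m i. cnj (\<Gamma> i $$ (e, c)) * \<Gamma> i $$ (e, d)) = (if c = d then of_real t else 0)"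
      if cd: "c < k" "d < k" for c d
    proof -
      have "\<Psi> i id_blinfun = 1\<^sub>m (m i)" using comb i by (simp add: UCP_def)
      then have "g i (id_blinfun, c, d) = (mat_adjoint (\<Gamma> i) * \<Gamma> i) $$ (c, d)"
        using g_index[OF i I cd] mat_adjoint_carrier[OF carr[OF i]] by simp
      then show ?thesis
        using adjoint_mult_index[OF carr[OF i] cd] g_eq[OF I cd] unit[OF cd]
        by (cases "c = d") (simp_all add: \<psi>_def)
    qed
    have "surjective_mat (m i) k (\<Gamma> i)" "0 < m i" using comb i by auto
    note unitary = proportional_isometry_unitary[OF this k t(1) iso]
    \<comment> \<open>The factor \<open>t\<close> of \<open>g_eq\<close> is absorbed as
      \<open>1 / sqrt t\<close> in each of the two copies of \<open>\<Gamma> i\<close>.\<close>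
    define u where "u = of_real (1 / sqrt t) \<cdot>\<^sub>m \<Gamma> i"
    have u: "u \<in> carrier_mat (m i) k" using carr[OF i] by (simp add: u_def)
    have "\<Phi> A = mat_adjoint u * \<Psi> i A * u" if A: "A \<in> S" for A
    proof (rule eq_matI)
      fix c d assume "c < dim_row (mat_adjoint u * \<Psi> i A * u)" "d < dim_col (mat_adjoint u * \<Psi> i A * u)"
      then have cd: "c < k" "d < k" using mat_adjoint_carrier[OF u] u by auto
      have "1 / sqrt t * (1 / sqrt t) = 1 / t" using unitary(2) by simp
      then have sq: "complex_of_real (1 / sqrt t) * of_real (1 / sqrt t) = of_real (1 / t)"
        by (metis of_real_mult)
      have "(mat_adjoint u * \<Psi> i A * u) $$ (c, d)
          = (\<Sum>a<m i. \<Sum>b<m i. cnj (u $$ (a, c)) * \<Psi> i A $$ (a, b) * u $$ (b, d))"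
        by (rule adjoint_mult_mult_index[OF u carr'[OF i A] cd])
      also have "\<dots> = (\<Sum>a<m i. \<Sum>b<m i. of_real (1 / t) *
          (cnj (\<Gamma> i $$ (a, c)) * \<Psi> i A $$ (a, b) * \<Gamma> i $$ (b, d)))"
      proof (intro sum.cong refl)
        fix a b assume "a \<in> {..<m i}" "b \<in> {..<m i}"
        then have "u $$ (a, c) = of_real (1 / sqrt t) * \<Gamma> i $$ (a, c)"
          "u $$ (b, d) = of_real (1 / sqrt t) * \<Gamma> i $$ (b, d)"
          using carr[OF i] cd by (auto simp: u_def)
        then show "cnj (u $$ (a, c)) * \<Psi> i A $$ (a, b) * u $$ (b, d)
            = of_real (1 / t) * (cnj (\<Gamma> i $$ (a, c)) * \<Psi> i A $$ (a, b) * \<Gamma> i $$ (b, d))"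
          unfolding sq[symmetric] by (simp only: complex_cnj_mult complex_cnj_complex_of_real mult_ac)
      qed
      also have "\<dots> = of_real (1 / t) * g i (A, c, d)"
        by (simp only: g_def form_compress_def prod.case sum_distrib_left)
      also have "\<dots> = \<psi> (A, c, d)" using g_eq[OF A cd] unitary(2) by simp
      finally show "\<Phi> A $$ (c, d) = (mat_adjoint u * \<Psi> i A * u) $$ (c, d)"
        using cd by (simp add: \<Phi>_def)
    qed (use mat_adjoint_carrier[OF u] u in \<open>auto simp: \<Phi>_def\<close>)
    then show ?thesis using unitary(1,3) u_def by blast
  qed
  ultimately have extreme: "matrix_extreme S k \<Phi>" using k unfolding matrix_extreme_def by blast
  have factor': "\<forall>A\<in>S. \<forall>a<n. \<forall>b<n. f (A, a, b) = form_compress k \<gamma> \<psi> (A, a, b)"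
    unfolding \<psi>_def using factor by blast
  show thesis by (rule that[OF \<psi> extreme[unfolded \<Phi>_def] factor'])
qed

section \<open>Complete positivity\<close>

lemma linear_between_sum:
  assumes "operator_system S" "linear_between S T \<phi>" "\<And>i. i \<in> I \<Longrightarrow> X i \<in> S"
  shows "\<phi> (\<Sum>i\<in>I. X i) = (\<Sum>i\<in>I. \<phi> (X i))"
proof -
  have "\<phi> (0 *\<^sub>C 0) = 0 *\<^sub>C \<phi> 0"
    using assms(2) operator_system_zero[OF assms(1)] unfolding linear_between_def by blast
  then have zero: "\<phi> 0 = 0" by simp
  show ?thesis using assms(3)
  proof (induction I rule: infinite_finite_induct)
    case (insert i I)
    have "(\<Sum>i\<in>I. X i) \<in> S" using insert by (intro operator_system_sum[OF assms(1)]) auto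
    then show ?case using insert assms(2) by (auto simp: linear_between_def)
  qed (simp_all add: zero)
qed

text \<open>Compressions have scalar coefficients, so linearity alone moves \<open>\<phi>\<close>
  past them; a matrix can be resized before \<open>\<phi>\<close> acts.\<close>

lemma linear_between_op_compress:
  assumes S: "operator_system S" and lin: "linear_between S T \<phi>" and X: "\<forall>i<n. \<forall>j<n. X i j \<in> S"
  shows "\<phi> (op_compress n \<alpha> X a b) = op_compress n \<alpha> (\<lambda>i j. \<phi> (X i j)) a b"
proof -
  have mem: "c *\<^sub>C A \<in> S" if "A \<in> S" for c A
    using that S by (simp add: operator_system_def)
  have "\<phi> (op_compress n \<alpha> X a b) = (\<Sum>i<n. \<Sum>j<n. \<phi> ((cnj (\<alpha> i a) * \<alpha> j b) *\<^sub>C X i j))"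
    unfolding op_compress_def using X mem
    by (subst linear_between_sum[OF S lin])
      (auto intro!: operator_system_sum[OF S] sum.cong linear_between_sum[OF S lin])
  also have "\<dots> = op_compress n \<alpha> (\<lambda>i j. \<phi> (X i j)) a b"
    unfolding op_compress_def using X lin by (intro sum.cong refl) (auto simp: linear_between_def)
  finally show ?thesis .
qed

text \<open>Vectors for the corner are extended by 0. This is how \<open>N\<close>-positivity serves
  all levels \<open>k \<le> N\<close>.\<close>

lemma positive_op_matrix_mono:
  fixes X :: "nat \<Rightarrow> nat \<Rightarrow> ('a::complex_hilbert \<Rightarrow>\<^sub>L 'a)"
  assumes "positive_op_matrix n X" "k \<le> n"
  shows "positive_op_matrix k X"
  unfolding positive_op_matrix_def
proof
  fix h :: "nat \<Rightarrow> 'a"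
  define g where "g = (\<lambda>i. if i < k then h i else 0)"
  have "0 \<le> (\<Sum>i<n. \<Sum>j<n. cinner (X i j (g j)) (g i))"
    using assms(1) by (simp add: positive_op_matrix_def)
  also have "\<dots> = (\<Sum>i<k. \<Sum>j<n. cinner (X i j (g j)) (g i))"
    using assms(2) by (intro sum.mono_neutral_right) (auto simp: g_def)
  also have "\<dots> = (\<Sum>i<k. \<Sum>j<k. cinner (X i j (g j)) (g i))"
    using assms(2) by (intro sum.cong refl sum.mono_neutral_right) (auto simp: g_def)
  also have "\<dots> = (\<Sum>i<k. \<Sum>j<k. cinner (X i j (h j)) (h i))"
    by (intro sum.cong refl) (simp add: g_def)
  finally show "0 \<le> (\<Sum>i<k. \<Sum>j<k. cinner (X i j (h j)) (h i))" .
qed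

theorem theorem4p8:
  fixes s :: "nat \<Rightarrow> ('a::complex_hilbert \<Rightarrow>\<^sub>L 'a)"
    and r :: "nat \<Rightarrow> ('b::complex_hilbert \<Rightarrow>\<^sub>L 'b)"
    and \<phi> :: "('b \<Rightarrow>\<^sub>L 'b) \<Rightarrow> ('a \<Rightarrow>\<^sub>L 'a)"
    and d N :: nat
  assumes "\<forall>i<d. s i \<in> bounded_operators"
    and "\<forall>i<d. r i \<in> bounded_operators"
    and "subhomogeneous N (generated_system d s)"
    and "linear_between (generated_system d r) (generated_system d s) \<phi>"
    and "\<forall>i<d. \<phi> (r i) = s i"
    and "\<phi> id_blinfun = id_blinfun"
    and "n_positive N (generated_system d r) \<phi>"
  shows "completely_positive (generated_system d r) \<phi>"
proof -
  let ?S = "generated_system d s"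
  let ?R = "generated_system d r"
  have S: "operator_system ?S" by (rule operator_system_generated[OF assms(1)])
  have R: "operator_system ?R" by (rule operator_system_generated[OF assms(2)])
  obtain G where G: "finite G" "G \<subseteq> ?S"
    "\<And>g. complex_linear_on ?S g \<Longrightarrow> \<forall>A\<in>G. g A = 0 \<Longrightarrow> \<forall>A\<in>?S. g A = 0"
    using generated_system_determined[OF assms(1)] by blast
  have "0 \<le> (\<Sum>i<n. \<Sum>j<n. cinner (\<phi> (X i j) (h j)) (h i))"
    if X: "\<forall>i<n. \<forall>j<n. X i j \<in> ?R" "positive_op_matrix n X" for n X h
  proof -
    define Y where "Y = (\<lambda>i j. \<phi> (X i j))"
    have Y: "\<forall>i<n. \<forall>j<n. Y i j \<in> ?S" using X(1) assms(4) by (simp add: Y_def linear_between_def)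
    have pure_pos: "0 \<le> pairing n f Y" if f: "f \<in> cp_base ?S n" "pure_form ?S n f" for f
    proof -
      obtain k \<gamma> \<psi> where \<psi>: "cp_form ?S k \<psi>"
        "matrix_extreme ?S k (\<lambda>A. mat k k (\<lambda>(c, d). \<psi> (A, c, d)))"
        "\<forall>A\<in>?S. \<forall>a<n. \<forall>b<n. f (A, a, b) = form_compress k \<gamma> \<psi> (A, a, b)"
        by (rule pure_form_matrix_extreme[OF S f]) (rule that)
      have "k \<le> N"
      proof (rule ccontr)
        assume "\<not> k \<le> N"
        then have "matrix_extreme_points ?S k = {}" using assms(3) by (simp add: subhomogeneous_def)
        then show False using \<psi>(2) by (auto simp: matrix_extreme_points_def)
      qed
      \<comment> \<open>The transpose of \<open>\<gamma>\<close> compresses \<open>X\<close> while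
        it still lies over the system of \<open>r\<close>, where positivity is available.\<close>
      define Z where "Z = op_compress n (\<lambda>a c. \<gamma> c a) X"
      have Z: "Z a b \<in> ?R" for a b unfolding Z_def by (rule op_compress_mem[OF R X(1)])
      have "\<forall>i<n. \<forall>j<n. X i j \<in> bounded_operators" using X(1) R by (auto simp: operator_system_def)
      \<comment> \<open>Only the rows of \<open>\<gamma>\<close> below \<open>k\<close> matter. Any
        others used to reach size \<open>N\<close> are arbitrary, do no harm to positivity, and are
        cut off afterwards.\<close>
      then have "positive_op_matrix N Z" unfolding Z_def by (rule positive_op_compress[OF _ X(2)])
      then have "positive_op_matrix N (\<lambda>i j. \<phi> (Z i j))" using assms(7) Z by (simp add: n_positive_def)
      then have "positive_op_matrix k (\<lambda>i j. \<phi> (Z i j))" using \<open>k \<le> N\<close> by (rule positive_op_matrix_mono)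
      moreover have "\<phi> (Z i j) \<in> ?S" for i j using Z assms(4) by (simp add: linear_between_def)
      ultimately have "0 \<le> pairing k \<psi> (\<lambda>i j. \<phi> (Z i j))" using \<psi>(1) by (simp add: cp_form_def)
      also have "(\<lambda>i j. \<phi> (Z i j)) = op_compress n (\<lambda>a c. \<gamma> c a) Y"
        unfolding Z_def Y_def by (intro ext linear_between_op_compress[OF R assms(4) X(1)])
      also have "pairing k \<psi> \<dots> = pairing n (form_compress k \<gamma> \<psi>) Y"
        using \<psi>(1) by (intro pairing_compress[OF S _ Y, symmetric]) (simp add: cp_form_def)
      also have "\<dots> = pairing n f Y"
        unfolding pairing_def using \<psi>(3) Y by (intro sum.cong refl) auto
      finally show ?thesis .
    qed
    \<comment> \<open>The vector form of \<open>h\<close>: its pairing with \<open>Y\<close> is the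
      quadratic form to be shown nonnegative.\<close>
    define f0 where "f0 = (\<lambda>(A :: 'a \<Rightarrow>\<^sub>L 'a, a, b). cinner (A (h b)) (h a))"
    have f0: "cp_form ?S n f0"
      by (auto simp: cp_form_def linear_form_def complex_linear_on_def f0_def pairing_def
        positive_op_matrix_def blinfun.add_left blinfun_apply_scaleC cinner_add_left cinner_scaleC_left)
    define \<tau> where "\<tau> = (\<Sum>a<n. (norm (h a))\<^sup>2)"
    have tr: "(\<Sum>a<n. f0 (id_blinfun, a, a)) = of_real \<tau>"
      by (simp add: f0_def cinner_self \<tau>_def)
    have "0 \<le> pairing n f0 Y"
    proof (cases "\<tau> = 0")
      case True
      then have "h a = 0" if "a < n" for a using that by (simp add: \<tau>_def sum_nonneg_eq_0_iff)
      then show ?thesis by (simp add: pairing_def f0_def)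
    next
      case False
      moreover have "0 \<le> \<tau>" unfolding \<tau>_def by (intro sum_nonneg) simp
      ultimately have \<tau>: "\<tau> > 0" by simp
      define f1 where "f1 = normalised_form ?S n \<tau> f0"
      have f1: "f1 \<in> cp_base ?S n" unfolding f1_def by (rule normalised_form_base[OF S f0 \<tau> tr])
      have "pairing n f1 Y = of_real (1 / \<tau>) * pairing n f0 Y"
        unfolding pairing_def sum_distrib_left
        using Y by (intro sum.cong refl) (simp add: f1_def normalised_form_def)
      then have scale: "pairing n f0 Y = of_real \<tau> * pairing n f1 Y" using \<tau> by simp
      \<comment> \<open>Admissible multipliers send nonnegative numbers to the closed right
        half-plane. Besides 1 these include \<open>\<i>\<close> and \<open>-\<i>\<close>, because
        nonnegative complex numbers are real; together the latter two kill the imaginary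
        part.\<close>
      have ge: "0 \<le> Re (c * pairing n f1 Y)" if "\<And>z. 0 \<le> z \<Longrightarrow> 0 \<le> Re (c * z)" for c
        using exists_pure_form[OF S G f1, of c Y] pure_pos that by force
      have "0 \<le> Re (pairing n f1 Y)" "Im (pairing n f1 Y) = 0"
        using ge[of 1] ge[of \<i>] ge[of "-\<i>"] by (simp_all add: less_eq_complex_def)
      then show ?thesis using \<tau> by (simp add: scale less_eq_complex_def)
    qed
    then show ?thesis by (simp add: pairing_def f0_def Y_def)
  qed
  then show ?thesis by (simp add: completely_positive_def n_positive_def positive_op_matrix_def)
qed

end
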